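(* Let $R=W(\mathbb F_2)[[x,y]]$ and $S=W(\mathbb F_2)[[t,y]]$, and let $\varphi:R\to S$ be the homomorphism of power series rings over $W(\mathbb F_2)$ defined by $\varphi(x)=t^2$, $\varphi(y)=y$. Let $P=(2,\ y^2-x^3)\subset R$, and let $PS$ denote the ideal of $S$ generated by $\varphi(P)$. Then: (1) $R$ and $S$ are complete regular local rings of characteristic zero; (2) $S$ is finite free of rank $2$ as an $R$-module (via $\varphi$), and $P$ is a prime ideal of $R$; (3) $S/\sqrt{PS}$ is regular and $R/P$ is not regular.
   Context: $W(\mathbb F_2)$ denotes the ring of ($2$-typical) Witt vectors of $\mathbb F_2$, i.e. the ring $\mathbb Z_2$ of $2$-adic integers. The map $\varphi$ is the unique continuous $W(\mathbb F_2)$-algebra homomorphism with the given values on $x,y$ (substitution of power series). $\sqrt{PS}$ is the radical of the ideal $PS$ in $S$. *)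

theory Defs
  imports
    "HOL-Algebra.Algebraic_Closure_Type"
    "HOL-Algebra.Ideal_Product"
    "HOL-Algebra.Ring_Divisibility"
    "HOL-Algebra.Module"
    "HOL-Library.Extended_Nat"
begin

section \<open>The ring of 2-adic integers\<close>

text \<open>
  \<open>W(F\<^sub>2) = Z\<^sub>2\<close> as the inverse limit of the rings \<open>Z/2\<^sup>n\<close>: an element is a compatible
  sequence of residues, each represented by its remainder in \<open>{0..<2\<^sup>n}\<close>.
\<close>

typedef padic2 = "{f :: nat \<Rightarrow> int. \<forall>n. f n \<in> {0..<2 ^ n} \<and> f (Suc n) mod 2 ^ n = f n}"
  by (rule exI[of _ "\<lambda>_. 0"]) auto

setup_lifting type_definition_padic2

lemma mod_Suc_pow2: "(a mod 2 ^ Suc n) mod 2 ^ n = a mod (2::int) ^ n"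
  by (rule mod_mod_cancel) (simp add: le_imp_power_dvd)

instantiation padic2 :: comm_ring_1
begin

lift_definition zero_padic2 :: padic2 is "\<lambda>_. 0" by simp

lift_definition one_padic2 :: padic2 is "\<lambda>n. 1 mod 2 ^ n"
  by (simp add: mod_Suc_pow2 del: power_Suc)

lift_definition plus_padic2 :: "padic2 \<Rightarrow> padic2 \<Rightarrow> padic2" is "\<lambda>f g n. (f n + g n) mod 2 ^ n"
  by (simp add: mod_Suc_pow2 del: power_Suc) (metis mod_add_eq)

lift_definition minus_padic2 :: "padic2 \<Rightarrow> padic2 \<Rightarrow> padic2" is "\<lambda>f g n. (f n - g n) mod 2 ^ n"
  by (simp add: mod_Suc_pow2 del: power_Suc) (metis mod_diff_eq)

lift_definition uminus_padic2 :: "padic2 \<Rightarrow> padic2" is "\<lambda>f n. (- f n) mod 2 ^ n"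
  by (simp add: mod_Suc_pow2 del: power_Suc) (metis mod_minus_eq)

lift_definition times_padic2 :: "padic2 \<Rightarrow> padic2 \<Rightarrow> padic2" is "\<lambda>f g n. (f n * g n) mod 2 ^ n"
  by (simp add: mod_Suc_pow2 del: power_Suc) (metis mod_mult_eq)

instance
proof
  fix a b c :: padic2
  show "a * b * c = a * (b * c)"
    by transfer (simp add: fun_eq_iff mod_simps mult.assoc)
  show "a * b = b * a"
    by transfer (simp add: mult.commute)
  show "1 * a = a"
  proof (transfer, rule ext)
    fix f :: "nat \<Rightarrow> int" and n
    assume f: "\<forall>n. f n \<in> {0..<2 ^ n} \<and> f (Suc n) mod 2 ^ n = f n"
    have "f n \<in> {0..<2 ^ n}" using f by blast
    then show "1 mod 2 ^ n * f n mod 2 ^ n = f n" by (cases "n = 0") (auto simp: mod_simps)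
  qed
  show "a + b + c = a + (b + c)"
    by transfer (simp add: fun_eq_iff mod_simps add.assoc)
  show "a + b = b + a"
    by transfer (simp add: add.commute)
  show "0 + a = a"
    by transfer (simp add: fun_eq_iff)
  show "- a + a = 0"
    by transfer (simp add: fun_eq_iff mod_simps)
  show "a - b = a + - b"
    by transfer (simp add: fun_eq_iff mod_simps)
  show "(a + b) * c = a * c + b * c"
    by transfer (simp add: fun_eq_iff mod_simps distrib_right)
  show "(0::padic2) \<noteq> 1"
    by transfer (auto simp: fun_eq_iff intro!: exI[of _ 1])
qed

end

lemma padic2_mod_le:
  assumes "\<forall>n. f n \<in> {0..<2 ^ n} \<and> f (Suc n) mod 2 ^ n = (f n :: int)"
  shows "f (m + k) mod 2 ^ m = f m"
proof (induction k)
  case 0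
  have "f m \<in> {0..<2 ^ m}" using assms by blast
  then show ?case by simp
next
  case (Suc k)
  have "f (m + Suc k) mod 2 ^ m = (f (Suc (m + k)) mod 2 ^ (m + k)) mod 2 ^ m"
    by (simp add: mod_mod_cancel le_imp_power_dvd)
  then show ?case using assms Suc by simp
qed

instance padic2 :: idom
proof
  show "a \<noteq> 0 \<Longrightarrow> b \<noteq> 0 \<Longrightarrow> a * b \<noteq> 0" for a b :: padic2
  proof (transfer, rule notI)
    fix f g :: "nat \<Rightarrow> int"
    assume f: "\<forall>n. f n \<in> {0..<2 ^ n} \<and> f (Suc n) mod 2 ^ n = f n" "f \<noteq> (\<lambda>_. 0)"
      and g: "\<forall>n. g n \<in> {0..<2 ^ n} \<and> g (Suc n) mod 2 ^ n = g n" "g \<noteq> (\<lambda>_. 0)"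
      and fg: "(\<lambda>n. f n * g n mod 2 ^ n) = (\<lambda>_. 0)"
    obtain m k where mk: "f m \<noteq> 0" "g k \<noteq> 0" using f(2) g(2) by (metis ext)
    let ?F = "f (m + k)" and ?G = "g (m + k)"
    have F: "\<not> 2 ^ m dvd ?F"
      using padic2_mod_le[OF f(1), of m k] mk by (auto simp: dvd_eq_mod_eq_0)
    have G: "\<not> 2 ^ k dvd ?G"
      using padic2_mod_le[OF g(1), of k m] mk by (auto simp: dvd_eq_mod_eq_0 add.commute)
    have nz: "?F \<noteq> 0" "?G \<noteq> 0" using F G by auto
    have "2 ^ (m + k) dvd ?F * ?G"
      using fun_cong[OF fg, of "m + k"] by (simp add: dvd_eq_mod_eq_0)
    then have "m + k \<le> multiplicity 2 (?F * ?G)"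
      using nz by (intro multiplicity_geI) auto
    also have "\<dots> = multiplicity 2 ?F + multiplicity 2 ?G"
      using nz by (intro prime_elem_multiplicity_mult_distrib) auto
    finally have "m \<le> multiplicity 2 ?F \<or> k \<le> multiplicity 2 ?G" by linarith
    then show False using F G multiplicity_dvd' by blast
  qed
qed


section \<open>Notions from commutative algebra\<close>

definition local_ring :: "('a, 'b) ring_scheme \<Rightarrow> bool" where
  "local_ring R \<longleftrightarrow> cring R \<and> (\<exists>!M. maximalideal M R)"

definition max_ideal :: "('a, 'b) ring_scheme \<Rightarrow> 'a set" where
  "max_ideal R = (THE M. maximalideal M R)"

definition krull_dim :: "('a, 'b) ring_scheme \<Rightarrow> enat" where
  "krull_dim R = Sup {enat n | n. \<exists>p :: nat \<Rightarrow> 'a set.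
     (\<forall>i\<le>n. primeideal (p i) R) \<and> (\<forall>i<n. p i \<subset> p (Suc i))}"

text \<open>
  A Noetherian local ring is regular if its maximal ideal can be generated by as many elements
  as its Krull dimension.
\<close>

definition regular_local_ring :: "('a, 'b) ring_scheme \<Rightarrow> bool" where
  "regular_local_ring R \<longleftrightarrow> noetherian_ring R \<and> local_ring R \<and>
     (\<exists>A. A \<subseteq> carrier R \<and> finite A \<and> enat (card A) = krull_dim R \<and> max_ideal R = Idl\<^bsub>R\<^esub> A)"

text \<open>
  A proper quotient of a Noetherian local ring is again one, so for such a quotient failure of
  \<^term>\<open>regular_local_ring\<close> concerns only the number of generators of the maximal ideal.
\<close>

lemma (in noetherian_ring) quotient_noetherian:
  assumes "ideal I R"
  shows "noetherian_ring (R Quot I)"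
proof (rule ring.noetherian_ringI[OF ideal.quotient_is_ring[OF assms]])
  fix J assume J: "ideal J (R Quot I)"
  let ?p = "(+>) I"
  interpret p: ring_hom_ring R "R Quot I" ?p by (rule ideal.rcos_ring_hom_ring[OF assms])
  have J_sub: "J \<subseteq> carrier (R Quot I)"
    using J by (rule additive_subgroup.a_subset[OF ideal.axioms(1)])
  obtain A where A: "A \<subseteq> carrier R" "finite A" "\<Union> J = Idl A"
    using finetely_gen[OF quot_ideal_imp_ring_ideal[OF assms J]] by blast
  have pA: "?p ` A \<subseteq> carrier (R Quot I)" using A(1) by auto
  have "?p ` A \<subseteq> J"
    using A genideal_self[OF A(1)] canonical_proj_vimage_mem_iff[OF assms J_sub] by blast
  then have "Idl\<^bsub>R Quot I\<^esub> (?p ` A) \<subseteq> J" by (rule p.S.genideal_minimal[OF J])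
  moreover have "J \<subseteq> Idl\<^bsub>R Quot I\<^esub> (?p ` A)"
  proof
    fix z assume z: "z \<in> J"
    then obtain r where r: "r \<in> carrier R" "z = ?p r"
      using J_sub unfolding FactRing_def A_RCOSETS_def'[of R I] by auto
    have "ideal {r \<in> carrier R. ?p r \<in> Idl\<^bsub>R Quot I\<^esub> (?p ` A)} R"
      by (rule p.ideal_vimage[OF p.S.genideal_ideal[OF pA]])
    moreover have "A \<subseteq> {r \<in> carrier R. ?p r \<in> Idl\<^bsub>R Quot I\<^esub> (?p ` A)}"
      using A(1) p.S.genideal_self[OF pA] by blast
    ultimately have "\<Union> J \<subseteq> {r \<in> carrier R. ?p r \<in> Idl\<^bsub>R Quot I\<^esub> (?p ` A)}"
      unfolding A(3) by (rule genideal_minimal)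
    moreover have "r \<in> \<Union> J"
      using canonical_proj_vimage_mem_iff[OF assms J_sub r(1)] z r(2) by simp
    ultimately show "z \<in> Idl\<^bsub>R Quot I\<^esub> (?p ` A)" using r(2) by blast
  qed
  ultimately show "\<exists>B \<subseteq> carrier (R Quot I). finite B \<and> J = Idl\<^bsub>R Quot I\<^esub> B"
    using pA A(2) by blast
qed

lemma (in noetherian_ring) proper_ideal_le_maximal:
  assumes "ideal I R" "I \<noteq> carrier R"
  obtains M where "maximalideal M R" "I \<subseteq> M"
proof -
  define S where "S = {J. ideal J R \<and> J \<noteq> carrier R \<and> I \<subseteq> J}"
  have "\<exists>M\<in>S. \<forall>J\<in>S. M \<subseteq> J \<longrightarrow> J = M"
  proof (rule subset_Zorn_nonempty)
    show "S \<noteq> {}" using assms S_def by blast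
    fix C assume C: "C \<noteq> {}" "subset.chain S C"
    then have "subset.chain {J. ideal J R} C" by (auto simp: subset_chain_def S_def)
    then have "\<Union> C \<in> C" using C(1) ideal_chain_is_trivial by blast
    then show "\<Union> C \<in> S" using C(2) by (auto simp: subset_chain_def)
  qed
  then obtain M where "M \<in> S" and max: "\<forall>J\<in>S. M \<subseteq> J \<longrightarrow> J = M" by blast
  then have M: "ideal M R" "M \<noteq> carrier R" "I \<subseteq> M" by (simp_all add: S_def)
  have "maximalideal M R"
  proof (rule maximalidealI[OF M(1) M(2)[symmetric]])
    fix J assume "ideal J R" "M \<subseteq> J"
    then show "J = M \<or> J = carrier R" using max M(3) by (auto simp: S_def)
  qed
  then show thesis using M(3) that by blast
qed

lemma quotient_noetherian_local:
  fixes R (structure)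
  assumes N: "noetherian_ring R" and L: "local_ring R"
    and I: "ideal I R" "I \<noteq> carrier R"
  shows "noetherian_ring (R Quot I) \<and> local_ring (R Quot I)"
proof
  interpret noetherian_ring R by (rule N)
  have R: "cring R" using L by (simp add: local_ring_def)
  show NQ: "noetherian_ring (R Quot I)" by (rule quotient_noetherian[OF I(1)])
  interpret Q: noetherian_ring "R Quot I" by (rule NQ)
  let ?p = "(+>) I"
  have inj: "J = K" if "ideal J (R Quot I)" "ideal K (R Quot I)" "\<Union> J = \<Union> K" for J K
  proof -
    have sub: "J \<subseteq> carrier (R Quot I)" "K \<subseteq> carrier (R Quot I)"
      using that(1,2) by (simp_all add: additive_subgroup.a_subset ideal.axioms(1))
    have "z \<in> J \<longleftrightarrow> z \<in> K" if z: "z \<in> carrier (R Quot I)" for z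
    proof -
      obtain r where r: "r \<in> carrier R" "z = ?p r"
        using z unfolding FactRing_def A_RCOSETS_def'[of R I] by auto
      show ?thesis
        using canonical_proj_vimage_mem_iff[OF I(1) sub(1) r(1)]
          canonical_proj_vimage_mem_iff[OF I(1) sub(2) r(1)] \<open>\<Union> J = \<Union> K\<close> r(2) by simp
    qed
    then show ?thesis using sub by blast
  qed
  have bij: "\<Union> (?p ` J) = J" if "ideal J R" "I \<subseteq> J" for J
    using ideal_incl_iff[OF I(1) that(1)] that(2) by simp
  have union_max: "maximalideal (\<Union> K) R" if K: "maximalideal K (R Quot I)" for K
  proof (rule maximalidealI)
    have Ki: "ideal K (R Quot I)" using K by (rule maximalideal.axioms(1))
    show UK: "ideal (\<Union> K) R" by (rule quot_ideal_imp_ring_ideal[OF I(1) Ki])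
    have Q1: "ideal (carrier (R Quot I)) (R Quot I)" by (rule Q.oneideal)
    have UQ: "\<Union> (carrier (R Quot I)) = carrier R"
      using canonical_proj_vimage_mem_iff[OF I(1) order_refl]
        canonical_proj_vimage_in_carrier[OF I(1) order_refl]
        ring_hom_closed[OF ideal.rcos_ring_hom[OF I(1)]] by blast
    show "carrier R \<noteq> \<Union> K"
      using inj[OF Ki Q1] UQ maximalideal.I_notcarr[OF K] by metis
    fix J assume J: "ideal J R" "\<Union> K \<subseteq> J" "J \<subseteq> carrier R"
    have "I \<in> K"
      using additive_subgroup.zero_closed[OF ideal.axioms(1)[OF Ki]] by (simp add: FactRing_def)
    then have IJ: "I \<subseteq> J" using J(2) by blast
    have pJ: "ideal (?p ` J) (R Quot I)" by (rule ring_ideal_imp_quot_ideal[OF I(1) J(1)])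
    have Ksub: "K \<subseteq> carrier (R Quot I)"
      using Ki by (simp add: additive_subgroup.a_subset ideal.axioms(1))
    have "K \<subseteq> ?p ` J"
    proof
      fix z assume z: "z \<in> K"
      then obtain r where r: "r \<in> carrier R" "z = ?p r"
        using Ksub unfolding FactRing_def A_RCOSETS_def'[of R I] by auto
      then have "r \<in> \<Union> K"
        using canonical_proj_vimage_mem_iff[OF I(1) Ksub r(1)] z by simp
      then show "z \<in> ?p ` J" using r(2) J(2) by blast
    qed
    moreover have "?p ` J \<subseteq> carrier (R Quot I)"
      using pJ by (simp add: additive_subgroup.a_subset ideal.axioms(1))
    ultimately have "?p ` J = K \<or> ?p ` J = carrier (R Quot I)"
      by (rule maximalideal.I_maximal[OF K pJ])
    then show "J = \<Union> K \<or> J = carrier R" using bij[OF J(1) IJ] UQ by metis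
  qed
  have "\<zero>\<^bsub>R Quot I\<^esub> \<noteq> \<one>\<^bsub>R Quot I\<^esub>"
  proof
    assume "\<zero>\<^bsub>R Quot I\<^esub> = \<one>\<^bsub>R Quot I\<^esub>"
    then have "I +> \<one> = I" by (simp add: FactRing_def)
    then have "\<one> \<in> I" using ideal.rcos_const_imp_mem[OF I(1)] by simp
    then show False using ideal.one_imp_carrier[OF I(1)] I(2) by blast
  qed
  then have "ideal {\<zero>\<^bsub>R Quot I\<^esub>} (R Quot I)" "{\<zero>\<^bsub>R Quot I\<^esub>} \<noteq> carrier (R Quot I)"
    using Q.zeroideal Q.one_closed by auto
  then obtain K where K: "maximalideal K (R Quot I)"
    by (rule Q.proper_ideal_le_maximal)
  have "K' = K" if "maximalideal K' (R Quot I)" for K'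
  proof (rule inj)
    show "\<Union> K' = \<Union> K"
      using L union_max[OF K] union_max[OF that] unfolding local_ring_def by blast
  qed (use K that in \<open>auto dest: maximalideal.axioms(1)\<close>)
  then show "local_ring (R Quot I)"
    unfolding local_ring_def using K ideal.quotient_is_cring[OF I(1) R] by blast
qed

text \<open>
  Completeness for the \<open>I\<close>-adic topology, including separatedness: the canonical map from
  \<open>R\<close> to the inverse limit of the quotients \<open>R/I\<^sup>n\<close> is injective and surjective.
\<close>

definition adically_complete :: "('a, 'b) ring_scheme \<Rightarrow> 'a set \<Rightarrow> bool" where
  "adically_complete R I \<longleftrightarrow>
     (\<Inter>n::nat. I [^]\<^bsub>ideals_set R\<^esub> n) = {\<zero>\<^bsub>R\<^esub>} \<and>
     (\<forall>s. (\<forall>n::nat. s n \<in> carrier R \<and> s (Suc n) \<ominus>\<^bsub>R\<^esub> s n \<in> I [^]\<^bsub>ideals_set R\<^esub> n) \<longrightarrow>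
        (\<exists>l \<in> carrier R. \<forall>n. l \<ominus>\<^bsub>R\<^esub> s n \<in> I [^]\<^bsub>ideals_set R\<^esub> n))"

definition complete_regular_local_ring :: "('a, 'b) ring_scheme \<Rightarrow> bool" where
  "complete_regular_local_ring R \<longleftrightarrow> regular_local_ring R \<and> adically_complete R (max_ideal R)"

definition char_zero :: "('a, 'b) ring_scheme \<Rightarrow> bool" where
  "char_zero R \<longleftrightarrow> (\<forall>n::nat. 0 < n \<longrightarrow> [n] \<cdot>\<^bsub>R\<^esub> \<one>\<^bsub>R\<^esub> \<noteq> \<zero>\<^bsub>R\<^esub>)"

definition ideal_radical :: "('a, 'b) ring_scheme \<Rightarrow> 'a set \<Rightarrow> 'a set" where
  "ideal_radical R I = {a \<in> carrier R. \<exists>n::nat. 0 < n \<and> a [^]\<^bsub>R\<^esub> n \<in> I}"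

definition restrict_scalars :: "('a \<Rightarrow> 'b) \<Rightarrow> ('b, 'c) ring_scheme \<Rightarrow> ('a, 'b) module" where
  "restrict_scalars h S = \<lparr>carrier = carrier S, monoid.mult = monoid.mult S, one = one S,
     ring.zero = ring.zero S, add = add S, module.smult = (\<lambda>r s. h r \<otimes>\<^bsub>S\<^esub> s)\<rparr>"

definition free_of_rank :: "('a, 'c) ring_scheme \<Rightarrow> ('a, 'b, 'd) module_scheme \<Rightarrow> nat \<Rightarrow> bool" where
  "free_of_rank R M n \<longleftrightarrow> module R M \<and>
     (\<exists>b \<in> {..<n} \<rightarrow> carrier M. \<forall>m \<in> carrier M.
        \<exists>!c. c \<in> {..<n} \<rightarrow>\<^sub>E carrier R \<and> m = (\<Oplus>\<^bsub>M\<^esub>i\<in>{..<n}. c i \<odot>\<^bsub>M\<^esub> b i))"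


section \<open>The rings and the homomorphism\<close>

text \<open>
  Power series in two variables are iterated: \<open>W[[x,y]]\<close> is \<open>W[[x]][[y]]\<close>, so the coefficient of
  \<open>x\<^sup>i y\<^sup>j\<close> in \<open>f\<close> is \<open>fps_nth (fps_nth f j) i\<close>. The rings \<open>R\<close> and \<open>S\<close> differ only in the name
  of the inner variable.
\<close>

definition ring_R :: "padic2 fps fps ring" where "ring_R = ring_of_type_algebra"
definition ring_S :: "padic2 fps fps ring" where "ring_S = ring_of_type_algebra"

definition x_R :: "padic2 fps fps" where "x_R = fps_const fps_X"
definition y_R :: "padic2 fps fps" where "y_R = fps_X"
definition t_S :: "padic2 fps fps" where "t_S = fps_const fps_X"
definition y_S :: "padic2 fps fps" where "y_S = fps_X"

text \<open>
  Substitution of \<open>t\<^sup>2\<close> for \<open>x\<close> in every coefficient of the series in \<open>y\<close>, that is,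
  \<open>\<Sum> a\<^sub>i\<^sub>j x\<^sup>i y\<^sup>j\<close> is sent to \<open>\<Sum> a\<^sub>i\<^sub>j t\<^bsup>2i\<^esup> y\<^sup>j\<close>.
\<close>

definition phi :: "padic2 fps fps \<Rightarrow> padic2 fps fps" where
  "phi f = Abs_fps (\<lambda>j. fps_nth f j oo fps_X ^ 2)"

definition ideal_P :: "padic2 fps fps set" where
  "ideal_P = Idl\<^bsub>ring_R\<^esub> {2, y_R ^ 2 - x_R ^ 3}"

definition ideal_PS :: "padic2 fps fps set" where
  "ideal_PS = Idl\<^bsub>ring_S\<^esub> (phi ` ideal_P)"

lemma phi_nth_nth:
  "fps_nth (fps_nth (phi f) j) k = (if even k then fps_nth (fps_nth f j) (k div 2) else 0)"
by (simp add: phi_def fps_nth_compose_X_power)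

lemma phi_x: "phi x_R = t_S ^ 2"
  by (rule fps_ext) (simp add: phi_def x_R_def t_S_def fps_const_power)

lemma phi_y: "phi y_R = y_S"
  by (rule fps_ext) (simp add: phi_def y_R_def y_S_def fps_X_def)

lemma phi_const: "phi (fps_const (fps_const a)) = fps_const (fps_const a)"
  by (rule fps_ext) (simp add: phi_def)

lemma phi_hom: "phi \<in> ring_hom ring_R ring_S"
proof (rule ring_hom_memI)
  have X: "fps_nth (fps_X ^ 2 :: padic2 fps) 0 = 0" by simp
  fix f g
  show "phi (f \<otimes>\<^bsub>ring_R\<^esub> g) = phi f \<otimes>\<^bsub>ring_S\<^esub> phi g"
    unfolding ring_R_def ring_S_def ring_of_type_algebra_def
    by (simp add: fps_eq_iff[where 'a = "padic2 fps"] phi_def fps_mult_nth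
        fps_compose_sum_distrib fps_compose_mult_distrib[OF X])
  show "phi (f \<oplus>\<^bsub>ring_R\<^esub> g) = phi f \<oplus>\<^bsub>ring_S\<^esub> phi g"
    unfolding ring_R_def ring_S_def ring_of_type_algebra_def
    by (simp add: fps_eq_iff[where 'a = "padic2 fps"] phi_def fps_compose_add_distrib)
  show "phi \<one>\<^bsub>ring_R\<^esub> = \<one>\<^bsub>ring_S\<^esub>"
    unfolding ring_R_def ring_S_def ring_of_type_algebra_def
    using phi_const[of 1] by simp
qed (simp add: ring_S_def ring_of_type_algebra_def)

end

theory Submission
  imports Defs
begin

text \<open>
  The maximal ideal of \<open>Z\<^sub>2[[x,y]]\<close> is generated by \<open>2, x, y\<close>; its powers are described by the
  2-adic valuations of the coefficients, which gives completeness. The dimension is bounded above by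
  Krull's principal ideal theorem: a chain of primes ending in a prime that contains \<open>x\<close> can be
  replaced by a chain one shorter all of whose members contain \<open>x\<close>.

  Modulo 2, \<open>y\<^sup>2 - t\<^sup>6\<close> is the square of \<open>y - t\<^sup>3\<close>, so the radical of \<open>PS\<close> is \<open>N = (2, y - t\<^sup>3)\<close>.
  Dividing by \<open>y - t\<^sup>3\<close> shows that \<open>S/N\<close> is \<open>F\<^sub>2[[t]]\<close>, so \<open>N\<close> is prime with regular quotient. Dividing
  by \<open>y\<^sup>2 - x\<^sup>3\<close> and separating even and odd powers of \<open>t\<close> shows that \<open>P\<close> is the preimage of \<open>N\<close>,
  hence prime. The quotient \<open>R/P\<close> has dimension at most 1, but its cotangent space has dimension 2.
\<close>

section \<open>Ideals of commutative rings on a type\<close>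

text \<open>The geometry behind the example: \<open>x = t^2\<close>, \<open>y = t^3\<close>
  parametrizes the cusp \<open>y^2 = x^3\<close>, so \<open>R/P\<close> is F_2[[t^2, t^3]] inside
  its normalization F_2[[t]], which is \<open>S/N\<close>. Pulling the cusp back along
  \<open>x = t^2\<close> gives two branches \<open>y = t^3\<close> and \<open>y = - t^3\<close>, and
  these coincide modulo 2; hence the residue characteristic 2.

  Krull's theorem is proved inside the ring itself: an ideal of the localization at \<open>P\<close>
  is represented by an ideal modulo which factors outside \<open>P\<close> cancel. Since regularity
  compares a number of generators with a dimension defined by chains, the induction that adjoins
  variables carries \<open>d\<close> generators together with a chain of primes of length
  \<open>d\<close>.

  \<open>R\<close> and \<open>S\<close> are one and the same HOL ring, so one induction from Z_2
  serves both, and facts about \<open>S\<close> may be phrased with \<open>x_R\<close> and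
  \<open>y_R\<close>. For \<open>R/P\<close> the bound on the dimension decides: a regular quotient
  would have its maximal ideal generated by one element, and comparing linear coefficients modulo 2
  excludes that.\<close>

abbreviation type_ring :: "'a::comm_ring_1 ring" where
  "type_ring \<equiv> ring_of_type_algebra"

lemma type_ring_simps [simp]:
  "carrier type_ring = UNIV" "a \<otimes>\<^bsub>type_ring\<^esub> b = a * b" "a \<oplus>\<^bsub>type_ring\<^esub> b = a + b"
  "\<one>\<^bsub>type_ring\<^esub> = 1" "\<zero>\<^bsub>type_ring\<^esub> = 0"
  by (simp_all add: ring_of_type_algebra_def)

lemma type_ring_cring: "cring (type_ring :: 'a::comm_ring_1 ring)"
  by (rule cring_from_type_algebra)

lemma type_ring_ring: "ring (type_ring :: 'a::comm_ring_1 ring)"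
  by (rule ring_from_type_algebra)

lemma type_ring_a_inv [simp]: "\<ominus>\<^bsub>type_ring\<^esub> a = - (a :: 'a::comm_ring_1)"
proof -
  interpret ring "type_ring :: 'a ring" by (rule type_ring_ring)
  show ?thesis using minus_equality[of "- a" a] by simp
qed

lemma type_ring_a_minus [simp]: "a \<ominus>\<^bsub>type_ring\<^esub> b = a - (b :: 'a::comm_ring_1)"
  by (simp add: a_minus_def)

lemma type_ring_pow [simp]: "a [^]\<^bsub>type_ring\<^esub> (n::nat) = (a :: 'a::comm_ring_1) ^ n"
proof -
  interpret ring "type_ring :: 'a ring" by (rule type_ring_ring)
  show ?thesis by (induction n) (simp_all add: mult.commute)
qed

text \<open>Negation is multiplication by \<open>- 1\<close>, so additive inverses come for free and
  an ideal is recognized by three closure conditions on a plain set.\<close>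

lemma ideal_type_ring_iff:
  "ideal I type_ring \<longleftrightarrow>
     (0 :: 'a::comm_ring_1) \<in> I \<and> (\<forall>a\<in>I. \<forall>b\<in>I. a + b \<in> I) \<and> (\<forall>a\<in>I. \<forall>r. r * a \<in> I)"
  (is "?L \<longleftrightarrow> ?R")
proof
  assume ?L
  then interpret ideal I type_ring .
  show ?R
    using additive_subgroup.a_closed[OF is_additive_subgroup]
      additive_subgroup.zero_closed[OF is_additive_subgroup] I_l_closed by simp
next
  assume R: ?R
  interpret ring "type_ring :: 'a ring" by (rule type_ring_ring)
  have "- a \<in> I" if "a \<in> I" for a
    using R that by (metis mult_minus1)
  then have "subgroup I (add_monoid type_ring)"
    by (intro add.subgroupI) (use R in \<open>auto simp flip: a_inv_def\<close>)
  then show ?L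
    by (rule idealI[OF type_ring_ring]) (use R in \<open>auto simp: mult.commute\<close>)
qed

lemma
  fixes I :: "'a::comm_ring_1 set"
  assumes "ideal I type_ring"
  shows ideal_zeroD: "0 \<in> I"
    and ideal_addD: "a \<in> I \<Longrightarrow> b \<in> I \<Longrightarrow> a + b \<in> I"
    and ideal_multD: "a \<in> I \<Longrightarrow> r * a \<in> I"
    and ideal_mult_rightD: "a \<in> I \<Longrightarrow> a * r \<in> I"
  using assms by (auto simp: ideal_type_ring_iff mult.commute)

lemma ideal_diffD:
  fixes I :: "'a::comm_ring_1 set"
  assumes "ideal I type_ring" "a \<in> I" "b \<in> I"
  shows "a - b \<in> I"
  using ideal_addD[OF assms(1,2) ideal_multD[OF assms(1,3), of "- 1"]] by simp

lemma ideal_sumD: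
  fixes I :: "'a::comm_ring_1 set"
  assumes "ideal I type_ring" "\<And>x. x \<in> A \<Longrightarrow> f x \<in> I"
  shows "(\<Sum>x\<in>A. f x) \<in> I"
  using assms(2) by (induction A rule: infinite_finite_induct)
    (auto intro: ideal_zeroD[OF assms(1)] ideal_addD[OF assms(1)])

lemma ideal_eq_UNIV_iff:
  fixes I :: "'a::comm_ring_1 set"
  assumes "ideal I type_ring"
  shows "I = UNIV \<longleftrightarrow> 1 \<in> I"
  using ideal_multD[OF assms, of 1] by auto

lemma primeideal_type_ring_iff:
  "primeideal I type_ring \<longleftrightarrow>
     ideal I type_ring \<and> (1 :: 'a::comm_ring_1) \<notin> I \<and> (\<forall>a b. a * b \<in> I \<longrightarrow> a \<in> I \<or> b \<in> I)"
  (is "?L \<longleftrightarrow> ?R")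
proof
  assume L: ?L
  then interpret primeideal I type_ring .
  show ?R using is_ideal I_notcarr I_prime one_imp_carrier by auto
next
  assume ?R
  then show ?L by (intro primeidealI[OF _ type_ring_cring]) auto
qed

lemma
  fixes I :: "'a::comm_ring_1 set"
  assumes "primeideal I type_ring"
  shows prime_idealD: "ideal I type_ring"
    and prime_oneD: "1 \<notin> I"
    and prime_multD: "a * b \<in> I \<Longrightarrow> a \<in> I \<or> b \<in> I"
  using assms by (auto simp: primeideal_type_ring_iff)

lemma prime_powerD:
  fixes I :: "'a::comm_ring_1 set"
  assumes "primeideal I type_ring" "a ^ n \<in> I"
  shows "a \<in> I"
  using assms(2) by (induction n) (auto dest: prime_multD[OF assms(1)] simp: prime_oneD[OF assms(1)])

definition ideal_plus :: "'a::comm_ring_1 set \<Rightarrow> 'a \<Rightarrow> 'a set" where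
  "ideal_plus I x = {a + r * x | a r. a \<in> I}"

lemma ideal_ideal_plus:
  assumes "ideal I type_ring"
  shows "ideal (ideal_plus I x) type_ring"
  unfolding ideal_type_ring_iff
proof (intro conjI ballI allI)
  show "0 \<in> ideal_plus I x"
    unfolding ideal_plus_def using ideal_zeroD[OF assms] by (force intro: exI[of _ 0])
  fix a assume "a \<in> ideal_plus I x"
  then obtain a' r where a: "a = a' + r * x" "a' \<in> I" by (auto simp: ideal_plus_def)
  show "s * a \<in> ideal_plus I x" for s
    unfolding ideal_plus_def a(1) using ideal_multD[OF assms a(2), of s]
    by (intro CollectI exI[of _ "s * a'"] exI[of _ "s * r"]) (auto simp: algebra_simps)
  fix b assume "b \<in> ideal_plus I x"
  then obtain b' r' where b: "b = b' + r' * x" "b' \<in> I" by (auto simp: ideal_plus_def)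
  show "a + b \<in> ideal_plus I x"
    unfolding ideal_plus_def a(1) b(1) using ideal_addD[OF assms a(2) b(2)]
    by (intro CollectI exI[of _ "a' + b'"] exI[of _ "r + r'"]) (auto simp: algebra_simps)
qed

lemma ideal_plus_superset: "I \<subseteq> ideal_plus I x"
  unfolding ideal_plus_def by (force intro: exI[of _ 0])

lemma ideal_plus_self:
  assumes "ideal I type_ring" shows "x \<in> ideal_plus I x"
  unfolding ideal_plus_def using ideal_zeroD[OF assms] by (force intro: exI[of _ 0] exI[of _ 1])

lemma ideal_plus_subset_iff:
  assumes "ideal I type_ring" "ideal J type_ring"
  shows "ideal_plus I x \<subseteq> J \<longleftrightarrow> I \<subseteq> J \<and> x \<in> J"
proof
  show "ideal_plus I x \<subseteq> J \<Longrightarrow> I \<subseteq> J \<and> x \<in> J"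
    using ideal_plus_superset ideal_plus_self[OF assms(1)] by blast
  show "I \<subseteq> J \<and> x \<in> J \<Longrightarrow> ideal_plus I x \<subseteq> J"
    by (auto simp: ideal_plus_def intro!: ideal_addD[OF assms(2)] ideal_multD[OF assms(2)])
qed

lemma Idl_insert:
  fixes x :: "'a::comm_ring_1"
  shows "Idl\<^bsub>type_ring\<^esub> (insert x A) = ideal_plus (Idl\<^bsub>type_ring\<^esub> A) x"
proof -
  interpret ring "type_ring :: 'a ring" by (rule type_ring_ring)
  have A: "ideal (Idl\<^bsub>type_ring\<^esub> A) type_ring" "ideal (Idl\<^bsub>type_ring\<^esub> (insert x A)) type_ring"
    by (simp_all add: genideal_ideal)
  show ?thesis
  proof
    show "Idl\<^bsub>type_ring\<^esub> (insert x A) \<subseteq> ideal_plus (Idl\<^bsub>type_ring\<^esub> A) x"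
      using genideal_self[of A] ideal_plus_superset ideal_plus_self[OF A(1)]
      by (intro genideal_minimal[OF ideal_ideal_plus[OF A(1)]]) auto
    show "ideal_plus (Idl\<^bsub>type_ring\<^esub> A) x \<subseteq> Idl\<^bsub>type_ring\<^esub> (insert x A)"
      unfolding ideal_plus_subset_iff[OF A]
      using genideal_self[of "insert x A"] genideal_minimal[OF A(2), of A] by auto
  qed
qed

lemma Idl_empty: "Idl\<^bsub>type_ring\<^esub> {} = {0 :: 'a::comm_ring_1}"
proof -
  interpret ring "type_ring :: 'a ring" by (rule type_ring_ring)
  show ?thesis using genideal_minimal[OF zeroideal, of "{}"] genideal_ideal[of "{}"]
    by (auto dest: ideal_zeroD)
qed

lemma Idl_finite:
  fixes A :: "'a::comm_ring_1 set"
  assumes "finite A"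
  shows "Idl\<^bsub>type_ring\<^esub> A = range (\<lambda>c. \<Sum>a\<in>A. c a * a)"
  using assms
proof (induction A rule: finite_induct)
  case empty
  show ?case by (simp add: Idl_empty)
next
  case (insert x A)
  show ?case unfolding Idl_insert insert.IH
  proof (intro equalityI subsetI)
    fix z assume "z \<in> ideal_plus (range (\<lambda>c. \<Sum>a\<in>A. c a * a)) x"
    then obtain c r where z: "z = (\<Sum>a\<in>A. c a * a) + r * x" by (auto simp: ideal_plus_def)
    have "(\<Sum>a\<in>A. c a * a) = (\<Sum>a\<in>A. (c(x := r)) a * a)"
      by (rule sum.cong) (use insert.hyps in auto)
    then have "z = (\<Sum>a\<in>insert x A. (c(x := r)) a * a)"
      using insert.hyps z by (simp add: add.commute)
    then show "z \<in> range (\<lambda>c. \<Sum>a\<in>insert x A. c a * a)" by blast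
  next
    fix z assume "z \<in> range (\<lambda>c. \<Sum>a\<in>insert x A. c a * a)"
    then obtain c where "z = (\<Sum>a\<in>A. c a * a) + c x * x" using insert.hyps by (auto simp: add.commute)
    then show "z \<in> ideal_plus (range (\<lambda>c. \<Sum>a\<in>A. c a * a)) x" by (auto simp: ideal_plus_def)
  qed
qed

section \<open>Maximal condition and ascending chain condition\<close>

lemma noetherian_maximal_ideal:
  fixes S :: "'a::comm_ring_1 set set"
  assumes N: "noetherian_ring (type_ring :: 'a ring)"
    and S: "S \<noteq> {}" "\<And>I. I \<in> S \<Longrightarrow> ideal I type_ring"
  obtains M where "M \<in> S" "\<And>J. J \<in> S \<Longrightarrow> M \<subseteq> J \<Longrightarrow> J = M"
proof -
  interpret noetherian_ring "type_ring :: 'a ring" by (rule N)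
  have "\<exists>M\<in>S. \<forall>J\<in>S. M \<subseteq> J \<longrightarrow> J = M"
  proof (rule subset_Zorn_nonempty[OF S(1)])
    fix C assume C: "C \<noteq> {}" "subset.chain S C"
    then have "subset.chain {J. ideal J type_ring} C" using S(2) by (auto simp: subset_chain_def)
    then have "\<Union> C \<in> C" using C(1) ideal_chain_is_trivial by blast
    then show "\<Union> C \<in> S" using C(2) by (auto simp: subset_chain_def)
  qed
  then show thesis using that by blast
qed

lemma noetherian_acc:
  fixes I :: "nat \<Rightarrow> 'a::comm_ring_1 set"
  assumes N: "noetherian_ring (type_ring :: 'a ring)"
    and I: "\<And>n. ideal (I n) type_ring" "\<And>n. I n \<subseteq> I (Suc n)"
  obtains N where "\<And>n. n \<ge> N \<Longrightarrow> I n = I N"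
proof -
  obtain M where M: "M \<in> range I" "\<And>J. J \<in> range I \<Longrightarrow> M \<subseteq> J \<Longrightarrow> J = M"
    using noetherian_maximal_ideal[OF N, of "range I"] I(1) by auto
  then obtain N where "M = I N" by blast
  moreover have "I N \<subseteq> I n" if "n \<ge> N" for n using I(2) that by (rule lift_Suc_mono_le)
  ultimately have "I n = I N" if "n \<ge> N" for n using M(2)[of "I n"] that by auto
  then show thesis by (rule that)
qed

section \<open>Krull's principal ideal theorem\<close>

text \<open>For a prime \<open>P\<close> these are the ideals of the localization at
  \<open>P\<close>, each represented by its contraction to the ring; \<open>UNIV\<close> represents
  the unit ideal.\<close>

definition saturated :: "'a::comm_ring_1 set \<Rightarrow> 'a set \<Rightarrow> bool" where
  "saturated P I \<longleftrightarrow> ideal I type_ring \<and> (\<forall>s b. s \<notin> P \<longrightarrow> s * b \<in> I \<longrightarrow> b \<in> I)"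

text \<open>For a prime \<open>P\<close> and an ideal \<open>I\<close> this extends \<open>I\<close>
  to the localization at \<open>P\<close> and contracts it back.\<close>

definition saturation :: "'a::comm_ring_1 set \<Rightarrow> 'a set \<Rightarrow> 'a set" where
  "saturation P I = {b. \<exists>s. s \<notin> P \<and> s * b \<in> I}"

lemma saturatedD:
  "saturated P I \<Longrightarrow> ideal I type_ring"
  "saturated P I \<Longrightarrow> s \<notin> P \<Longrightarrow> s * b \<in> I \<Longrightarrow> b \<in> I"
  unfolding saturated_def by metis+

lemma saturatedI:
  assumes "ideal I type_ring" "\<And>s b. s \<notin> P \<Longrightarrow> s * b \<in> I \<Longrightarrow> b \<in> I"
  shows "saturated P I"
  unfolding saturated_def using assms by metis

lemma saturationI: "s \<notin> P \<Longrightarrow> s * b \<in> I \<Longrightarrow> b \<in> saturation P I"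
  unfolding saturation_def by blast

lemma saturationE:
  assumes "b \<in> saturation P I"
  obtains s where "s \<notin> P" "s * b \<in> I"
  using assms unfolding saturation_def by blast

lemma saturation_superset:
  assumes "primeideal P type_ring" shows "I \<subseteq> saturation P I"
  using saturationI[OF prime_oneD[OF assms]] by auto

lemma saturation_mono: "I \<subseteq> J \<Longrightarrow> saturation P I \<subseteq> saturation P J"
  by (blast intro: saturationI elim: saturationE)

lemma saturation_subset_iff:
  assumes "primeideal P type_ring" "saturated P J"
  shows "saturation P I \<subseteq> J \<longleftrightarrow> I \<subseteq> J"
proof
  show "saturation P I \<subseteq> J \<Longrightarrow> I \<subseteq> J"
    using saturation_superset[OF assms(1), of I] by (rule subset_trans)
  show "saturation P I \<subseteq> J" if "I \<subseteq> J"
  proof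
    fix b assume "b \<in> saturation P I"
    then obtain s where "s \<notin> P" "s * b \<in> I" by (rule saturationE)
    then show "b \<in> J" using saturatedD(2)[OF assms(2), of s b] that by auto
  qed
qed

lemma saturated_saturation:
  assumes P: "primeideal P type_ring" and I: "ideal I type_ring"
  shows "saturated P (saturation P I)"
proof -
  have mult: "s * s' \<notin> P" if "s \<notin> P" "s' \<notin> P" for s s'
    using that prime_multD[OF P] by blast
  have "ideal (saturation P I) type_ring"
    unfolding ideal_type_ring_iff
  proof (intro conjI ballI allI)
    show "0 \<in> saturation P I"
      using saturation_superset[OF P] ideal_zeroD[OF I] by blast
    fix a assume "a \<in> saturation P I"
    then obtain s where s: "s \<notin> P" "s * a \<in> I" by (rule saturationE)
    show "r * a \<in> saturation P I" for r
      using ideal_multD[OF I s(2), of r] by (intro saturationI[OF s(1)]) (simp add: mult.left_commute)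
    fix b assume "b \<in> saturation P I"
    then obtain s' where s': "s' \<notin> P" "s' * b \<in> I" by (rule saturationE)
    have "s' * (s * a) + s * (s' * b) \<in> I"
      by (intro ideal_addD[OF I] ideal_multD[OF I] s s')
    then have "s * s' * (a + b) \<in> I" by (simp add: algebra_simps)
    then show "a + b \<in> saturation P I" by (rule saturationI[OF mult[OF s(1) s'(1)]])
  qed
  then show ?thesis
  proof (rule saturatedI)
    fix s b assume s: "s \<notin> P" and "s * b \<in> saturation P I"
    then obtain s' where s': "s' \<notin> P" "s' * (s * b) \<in> I" by (elim saturationE)
    then have "(s' * s) * b \<in> I" by (simp add: mult.assoc)
    then show "b \<in> saturation P I" by (rule saturationI[OF mult[OF s'(1) s]])
  qed
qed

lemma saturated_Int:
  assumes "saturated P I" "saturated P J"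
  shows "saturated P (I \<inter> J)"
proof (rule saturatedI)
  show "ideal (I \<inter> J) type_ring"
    using assms[THEN saturatedD(1)] by (simp add: ideal_type_ring_iff)
  show "b \<in> I \<inter> J" if "s \<notin> P" "s * b \<in> I \<inter> J" for s b
    using assms[THEN saturatedD(2), OF that(1), of b] that(2) by simp
qed

text \<open>\<open>P\<close> is an associated prime of the quotient by \<open>L\<close>. A maximal
  annihilator of a nonzero class modulo \<open>L\<close> is prime; it contains \<open>K\<close>
  because \<open>L\<close> does, and it lies in \<open>P\<close> because \<open>L\<close> is
  saturated, so minimality of \<open>P\<close> over \<open>K\<close> identifies it with
  \<open>P\<close>.\<close>

lemma annihilator_of_maximal_prime:
  fixes P :: "'a::comm_ring_1 set"
  assumes N: "noetherian_ring (type_ring :: 'a ring)"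
    and P: "primeideal P type_ring"
    and min: "\<And>Q. primeideal Q type_ring \<Longrightarrow> K \<subseteq> Q \<Longrightarrow> Q \<subseteq> P \<Longrightarrow> Q = P"
    and L: "saturated P L" "K \<subseteq> L" "L \<noteq> UNIV"
  obtains w where "w \<notin> L" "\<And>p. p \<in> P \<Longrightarrow> p * w \<in> L"
proof -
  define ann where "ann w = {r. r * w \<in> L}" for w
  note Li = saturatedD(1)[OF L(1)]
  have ideal_ann: "ideal (ann w) type_ring" for w
    unfolding ideal_type_ring_iff ann_def
    using ideal_zeroD[OF Li] ideal_addD[OF Li] ideal_multD[OF Li]
    by (auto simp: distrib_right mult.assoc)
  obtain M where M: "M \<in> ann ` (- L)" "\<And>J. J \<in> ann ` (- L) \<Longrightarrow> M \<subseteq> J \<Longrightarrow> J = M"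
    by (rule noetherian_maximal_ideal[OF N, of "ann ` (- L)"]) (use L(3) ideal_ann in auto)
  then obtain w where w: "w \<notin> L" "M = ann w" by blast
  have "primeideal M type_ring"
    unfolding primeideal_type_ring_iff
  proof (intro conjI allI impI)
    show "ideal M type_ring" using ideal_ann w by simp
    show "1 \<notin> M" using w by (simp add: ann_def)
    fix a b assume ab: "a * b \<in> M"
    show "a \<in> M \<or> b \<in> M"
    proof (rule disjCI)
      assume "b \<notin> M"
      then have "b * w \<notin> L" by (simp add: w ann_def)
      moreover have "M \<subseteq> ann (b * w)"
        using ideal_multD[OF Li, of _ b] by (auto simp: w ann_def mult.left_commute[of _ b])
      ultimately have "ann (b * w) = M" using M(2) by blast
      moreover have "a \<in> ann (b * w)" using ab by (simp add: w ann_def mult.assoc)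
      ultimately show "a \<in> M" by simp
    qed
  qed
  moreover have "K \<subseteq> M" using L(2) ideal_mult_rightD[OF Li] by (auto simp: w ann_def)
  moreover have "M \<subseteq> P"
  proof
    fix r assume "r \<in> M"
    then have "r * w \<in> L" by (simp add: w ann_def)
    then show "r \<in> P" using saturatedD(2)[OF L(1), of r w] w(1) by auto
  qed
  ultimately have "M = P" by (rule min)
  then have "p * w \<in> L" if "p \<in> P" for p using that by (auto simp: w ann_def)
  then show thesis using that w(1) by blast
qed

text \<open>
  Noetherian induction on \<open>L\<close>: passing to \<open>L' = L + (w)\<close> with \<open>P w \<subseteq> L\<close> adds a one-dimensional
  vector space over the residue field of \<open>P\<close>. This is the Artinian property of the localization
  at \<open>P\<close> of the quotient by \<open>K\<close>.
\<close>

lemma saturated_dcc: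
  fixes P :: "'a::comm_ring_1 set"
  assumes N: "noetherian_ring (type_ring :: 'a ring)"
    and P: "primeideal P type_ring"
    and min: "\<And>Q. primeideal Q type_ring \<Longrightarrow> K \<subseteq> Q \<Longrightarrow> Q \<subseteq> P \<Longrightarrow> Q = P"
    and J: "\<And>n::nat. saturated P (J n)" "\<And>n. K \<subseteq> J n" "\<And>n. J (Suc n) \<subseteq> J n"
    and K: "saturated P K"
  obtains n where "\<And>m. m \<ge> n \<Longrightarrow> J m = J n"
proof -
  define stable where "stable J \<longleftrightarrow> (\<exists>n::nat. \<forall>m\<ge>n. J m = J n)" for J :: "nat \<Rightarrow> 'a set"
  define dcc where "dcc L \<longleftrightarrow> (\<forall>J. (\<forall>n. saturated P (J n) \<and> L \<subseteq> J n \<and> J (Suc n) \<subseteq> J n) \<longrightarrow> stable J)"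
    for L
  have "dcc K"
  proof (rule ccontr)
    assume nK: "\<not> dcc K"
    let ?S = "{L. saturated P L \<and> K \<subseteq> L \<and> \<not> dcc L}"
    obtain L where "L \<in> ?S" and max: "\<And>L'. L' \<in> ?S \<Longrightarrow> L \<subseteq> L' \<Longrightarrow> L' = L"
      by (rule noetherian_maximal_ideal[OF N, of ?S]) (use K nK in \<open>auto dest: saturatedD\<close>)
    then have L: "saturated P L" "K \<subseteq> L" "\<not> dcc L" by auto
    note Li = saturatedD(1)[OF L(1)]
    have "dcc UNIV" by (auto simp: dcc_def stable_def)
    then have "L \<noteq> UNIV" using L(3) by auto
    then obtain w where w: "w \<notin> L" "\<And>p. p \<in> P \<Longrightarrow> p * w \<in> L"
      using annihilator_of_maximal_prime[OF N P min L(1,2)] by blast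
    define L' where "L' = saturation P (ideal_plus L w)"
    have L': "saturated P L'"
      unfolding L'_def by (rule saturated_saturation[OF P ideal_ideal_plus[OF Li]])
    have LL': "L \<subseteq> L'" and wL': "w \<in> L'"
      using saturation_superset[OF P] ideal_plus_superset ideal_plus_self[OF Li]
      unfolding L'_def by blast+
    have "dcc L'"
      using max[of L'] L' LL' wL' w(1) L(2) by auto
    \<comment> \<open>If \<open>A\<close> is not \<open>L'\<close>, it misses \<open>w\<close>. For
      \<open>b\<close> in \<open>A\<close> with \<open>s * b = l + c * w\<close>, a coefficient
      \<open>c\<close> outside \<open>P\<close> would put \<open>w\<close> into \<open>A\<close>; so
      \<open>c\<close> is in \<open>P\<close>, and \<open>P w\<close> lies in
      \<open>L\<close>.\<close>
    have one_dim: "A = L \<or> A = L'" if A: "saturated P A" "L \<subseteq> A" "A \<subseteq> L'" for A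
    proof (rule disjCI)
      assume "A \<noteq> L'"
      note Ai = saturatedD(1)[OF A(1)]
      have wA: "w \<notin> A"
      proof
        assume "w \<in> A"
        then have "L' \<subseteq> A" unfolding L'_def saturation_subset_iff[OF P A(1)]
          ideal_plus_subset_iff[OF Li Ai] using A(2) by simp
        then show False using A(3) \<open>A \<noteq> L'\<close> by auto
      qed
      have "b \<in> L" if b: "b \<in> A" for b
      proof -
        obtain s l c where s: "s \<notin> P" "s * b = l + c * w" "l \<in> L"
          using subsetD[OF A(3) b] unfolding L'_def saturation_def ideal_plus_def by blast
        have "c * w = s * b - l" using s(2) by simp
        also have "\<dots> \<in> A" using b s(3) A(2) by (intro ideal_diffD[OF Ai] ideal_multD[OF Ai]) auto
        finally have "c \<in> P" using saturatedD(2)[OF A(1), of c w] wA by auto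
        then have "s * b \<in> L" unfolding s(2) using w(2) s(3) by (intro ideal_addD[OF Li]) auto
        then show "b \<in> L" by (rule saturatedD(2)[OF L(1) s(1)])
      qed
      then show "A = L" using A(2) by auto
    qed
    have "stable J" if J: "\<And>n. saturated P (J n)" "\<And>n. L \<subseteq> J n" "\<And>n. J (Suc n) \<subseteq> J n" for J
    proof -
      have anti: "J m \<subseteq> J n" if "m \<ge> n" for m n using J(3) that by (rule lift_Suc_antimono_le)
      \<comment> \<open>\<open>U n\<close> represents the sum of \<open>J n\<close> and
        \<open>L'\<close>. These sums stabilize by \<open>dcc L'\<close> and the intersections of
        \<open>J n\<close> with \<open>L'\<close> stabilize by \<open>one_dim\<close>; the modular
        law then stabilizes \<open>J\<close>, up to factors outside \<open>P\<close>.\<close>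
      define U where "U n = saturation P {a + b | a b. a \<in> J n \<and> b \<in> L'}" for n
      have "ideal {a + b | a b. a \<in> J n \<and> b \<in> L'} type_ring" for n
        unfolding ideal_type_ring_iff
      proof (intro conjI ballI allI)
        note I = saturatedD(1)[OF J(1), of n] saturatedD(1)[OF L']
        show "0 \<in> {a + b | a b. a \<in> J n \<and> b \<in> L'}"
          using I[THEN ideal_zeroD] by force
        fix u assume "u \<in> {a + b | a b. a \<in> J n \<and> b \<in> L'}"
        then obtain a b where u: "u = a + b" "a \<in> J n" "b \<in> L'" by auto
        show "r * u \<in> {a + b | a b. a \<in> J n \<and> b \<in> L'}" for r
          using u ideal_multD[OF I(1) u(2), of r] ideal_multD[OF I(2) u(3), of r]
          by (auto simp: distrib_left)
        fix v assume "v \<in> {a + b | a b. a \<in> J n \<and> b \<in> L'}"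
        then obtain c d where v: "v = c + d" "c \<in> J n" "d \<in> L'" by auto
        have "u + v = (a + c) + (b + d)" using u v by simp
        then show "u + v \<in> {a + b | a b. a \<in> J n \<and> b \<in> L'}"
          using ideal_addD[OF I(1) u(2) v(2)] ideal_addD[OF I(2) u(3) v(3)] by blast
      qed
      then have "saturated P (U n)" for n unfolding U_def by (rule saturated_saturation[OF P])
      moreover have L'U: "L' \<subseteq> U n" for n
      proof -
        have "L' \<subseteq> {a + b | a b. a \<in> J n \<and> b \<in> L'}"
          using ideal_zeroD[OF saturatedD(1)[OF J(1)], of n] by force
        then show ?thesis unfolding U_def using saturation_superset[OF P] by blast
      qed
      moreover have "U (Suc n) \<subseteq> U n" for n
        unfolding U_def by (rule saturation_mono) (use J(3)[of n] in blast)
      ultimately have "stable U" using \<open>dcc L'\<close> by (simp add: dcc_def)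
      then obtain n1 where n1: "\<And>m. m \<ge> n1 \<Longrightarrow> U m = U n1" by (auto simp: stable_def)
      have JL: "J n \<inter> L' = L \<or> J n \<inter> L' = L'" for n
        using one_dim[OF saturated_Int[OF J(1) L']] J(2) LL' by blast
      have "\<exists>n. \<forall>m\<ge>n. J m \<inter> L' = J n \<inter> L'"
      proof (cases "\<exists>n. J n \<inter> L' = L")
        case True
        then obtain n where "J n \<inter> L' = L" by blast
        then have "J m \<inter> L' = L" if "m \<ge> n" for m
          using anti[OF that] J(2)[of m] LL' by blast
        then show ?thesis by blast
      next
        case False
        then show ?thesis using JL by metis
      qed
      then obtain n2 where n2: "\<And>m. m \<ge> n2 \<Longrightarrow> J m \<inter> L' = J n2 \<inter> L'" by blast
      define n where "n = max n1 n2"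
      have "J n \<subseteq> J m" if "m \<ge> n" for m
      proof
        fix b assume b: "b \<in> J n"
        have "b \<in> {a + b | a b. a \<in> J n \<and> b \<in> L'}"
          using b ideal_zeroD[OF saturatedD(1)[OF L']] by force
        then have "b \<in> U n" unfolding U_def by (rule subsetD[OF saturation_superset[OF P]])
        then have "b \<in> U m" using n1[of n] n1[of m] that by (simp add: n_def)
        then obtain s c l where s: "s \<notin> P" "s * b = c + l" "c \<in> J m" "l \<in> L'"
          unfolding U_def saturation_def by blast
        have "l = s * b - c" using s(2) by simp
        also have "\<dots> \<in> J n"
          using b s(3) anti[OF that]
          by (intro ideal_diffD[OF saturatedD(1)[OF J(1)]] ideal_multD[OF saturatedD(1)[OF J(1)]]) auto
        finally have "l \<in> J m" using n2[of n] n2[of m] s(4) that by (auto simp: n_def)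
        then have "s * b \<in> J m"
          unfolding s(2) using s(3) by (intro ideal_addD[OF saturatedD(1)[OF J(1)]])
        then show "b \<in> J m" by (rule saturatedD(2)[OF J(1) s(1)])
      qed
      then have "\<forall>m\<ge>n. J m = J n" using anti by blast
      then show ?thesis unfolding stable_def by blast
    qed
    then have "dcc L" by (simp add: dcc_def)
    then show False using L(3) by simp
  qed
  then have "stable J" using J by (simp add: dcc_def)
  then show thesis using that by (auto simp: stable_def)
qed

text \<open>The proof avoids symbolic powers of \<open>Q\<close>. Take \<open>y\<close> in
  \<open>Q\<close> outside \<open>P\<^sub>0\<close> and let \<open>I k\<close> be the ideal of all
  \<open>b\<close> that some power of \<open>x\<close> carries into
  \<open>P\<^sub>0 + (y ^ k)\<close>, locally at \<open>P\<close>. Modulo \<open>x\<close> the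
  descending chain of the \<open>I k\<close> becomes stationary; because \<open>x\<close> cancels in
  \<open>I k\<close>, this forces \<open>y ^ k\<close> into \<open>I (Suc k)\<close>. Cancelling
  \<open>y ^ k\<close> modulo \<open>P\<^sub>0\<close> then gives an element outside
  \<open>P\<close> times a power of \<open>x\<close> in \<open>Q\<close>, which is
  impossible.\<close>

theorem krull_principal_ideal:
  fixes P :: "'a::comm_ring_1 set"
  assumes N: "noetherian_ring (type_ring :: 'a ring)"
    and pr: "primeideal P\<^sub>0 type_ring" "primeideal Q type_ring" "primeideal P type_ring"
    and strict: "P\<^sub>0 \<subset> Q" "Q \<subset> P"
    and x: "x \<in> P"
    and min: "\<And>Q. primeideal Q type_ring \<Longrightarrow> P\<^sub>0 \<subseteq> Q \<Longrightarrow> x \<in> Q \<Longrightarrow> Q \<subseteq> P \<Longrightarrow> Q = P"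
  shows False
proof -
  obtain y where y: "y \<in> Q" "y \<notin> P\<^sub>0" using strict(1) by (rule psubsetE) auto
  note P0i = prime_idealD[OF pr(1)]
  have mult: "s * s' \<notin> P" if "s \<notin> P" "s' \<notin> P" for s s'
    using that prime_multD[OF pr(3)] by blast
  have xQ: "x \<notin> Q" using min[OF pr(2)] strict by auto
  define M where "M k l = {b. x ^ l * b \<in> saturation P (ideal_plus P\<^sub>0 (y ^ k))}" for k l
  have satM: "saturated P (M k l)" for k l
  proof -
    have S: "saturated P (saturation P (ideal_plus P\<^sub>0 (y ^ k)))"
      by (rule saturated_saturation[OF pr(3) ideal_ideal_plus[OF P0i]])
    note Si = saturatedD(1)[OF S]
    show ?thesis
    proof (rule saturatedI)
      show "ideal (M k l) type_ring"
        unfolding M_def ideal_type_ring_iff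
        using ideal_zeroD[OF Si] ideal_addD[OF Si] ideal_multD[OF Si]
        by (simp add: distrib_left mult.left_commute[of "x ^ l"])
      show "b \<in> M k l" if "s \<notin> P" "s * b \<in> M k l" for s b
        using saturatedD(2)[OF S that(1), of "x ^ l * b"] that(2)
        by (simp add: M_def mult.left_commute)
    qed
  qed
  have M_Suc: "M k l \<subseteq> M k (Suc l)" for k l
  proof
    fix b assume "b \<in> M k l"
    then show "b \<in> M k (Suc l)"
      using ideal_multD[OF saturatedD(1)[OF saturated_saturation[OF pr(3) ideal_ideal_plus[OF P0i]]],
          of "x ^ l * b" "y ^ k" x]
      by (simp add: M_def mult.assoc)
  qed
  have M_mono: "M k l \<subseteq> M k l'" if "l \<le> l'" for k l l' using M_Suc that by (rule lift_Suc_mono_le)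
  define I where "I k = (\<Union>l. M k l)" for k
  have "\<exists>l. I k = M k l" for k
  proof -
    obtain l where l: "\<And>m. m \<ge> l \<Longrightarrow> M k m = M k l"
      by (rule noetherian_acc[OF N, of "M k"]) (use satM M_Suc in \<open>auto dest: saturatedD\<close>)
    have "M k m \<subseteq> M k l" for m using l[of "max l m"] M_mono[of m "max l m" k] by simp
    then show ?thesis unfolding I_def by blast
  qed
  \<comment> \<open>The ascending chain condition bounds the exponent: \<open>x ^ L k\<close> alone
    carries all of \<open>I k\<close> into the saturation of
    \<open>P\<^sub>0 + (y ^ k)\<close>.\<close>
  then obtain L where L: "\<And>k. I k = M k (L k)" by metis
  have satI: "saturated P (I k)" for k using satM[of k "L k"] by (simp add: L)
  note Ii = saturatedD(1)[OF satI]
  have I_divx: "b \<in> I k" if "x * b \<in> I k" for b k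
  proof -
    have "b \<in> M k (Suc (L k))" using that by (simp add: L M_def ac_simps)
    then show ?thesis by (auto simp: I_def)
  qed
  have I_anti: "I (Suc k) \<subseteq> I k" for k
  proof -
    have "ideal_plus P\<^sub>0 (y ^ Suc k) \<subseteq> ideal_plus P\<^sub>0 (y ^ k)"
      unfolding ideal_plus_subset_iff[OF P0i ideal_ideal_plus[OF P0i]]
      using ideal_plus_superset ideal_multD[OF ideal_ideal_plus[OF P0i] ideal_plus_self[OF P0i]]
      by auto
    from saturation_mono[OF this] show ?thesis unfolding I_def M_def by blast
  qed
  have I_base: "ideal_plus P\<^sub>0 (y ^ k) \<subseteq> I k" for k
  proof
    fix b assume "b \<in> ideal_plus P\<^sub>0 (y ^ k)"
    then have "b \<in> M k 0" using saturation_superset[OF pr(3)] by (auto simp: M_def)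
    then show "b \<in> I k" by (auto simp: I_def)
  qed
  have P0_I: "P\<^sub>0 \<subseteq> I k" for k
    using ideal_plus_superset I_base by (rule subset_trans)
  define J where "J k = saturation P (ideal_plus (I k) x)" for k
  define K where "K = saturation P (ideal_plus P\<^sub>0 x)"
  have satJ: "saturated P (J k)" for k
    unfolding J_def by (rule saturated_saturation[OF pr(3) ideal_ideal_plus[OF Ii]])
  have J_mono: "ideal_plus A x \<subseteq> ideal_plus B x" if "A \<subseteq> B" for A B
    using that by (auto simp: ideal_plus_def)
  obtain k where k: "\<And>m. m \<ge> k \<Longrightarrow> J m = J k"
  proof (rule saturated_dcc[OF N pr(3), of K J])
    show "Q = P" if "primeideal Q type_ring" "K \<subseteq> Q" "Q \<subseteq> P" for Q
    proof (rule min[OF that(1) _ _ that(3)])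
      have "ideal_plus P\<^sub>0 x \<subseteq> Q"
        using saturation_superset[OF pr(3)] that(2) unfolding K_def by (rule subset_trans)
      then show "P\<^sub>0 \<subseteq> Q" "x \<in> Q"
        by (simp_all add: ideal_plus_subset_iff[OF P0i prime_idealD[OF that(1)]])
    qed
    show "saturated P (J n)" for n by (rule satJ)
    show "saturated P K" unfolding K_def by (rule saturated_saturation[OF pr(3) ideal_ideal_plus[OF P0i]])
    show "K \<subseteq> J n" for n
      unfolding K_def J_def by (intro saturation_mono J_mono P0_I)
    show "J (Suc n) \<subseteq> J n" for n
      unfolding J_def by (intro saturation_mono J_mono I_anti)
  qed (rule that)
  \<comment> \<open>Locally at \<open>P\<close>, \<open>I k = I (Suc k) + x I k\<close>:
    stationarity modulo \<open>x\<close> yields some cofactor \<open>d\<close>, and it lies in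
    \<open>I k\<close> since \<open>x * d\<close> does.\<close>
  have step: "\<exists>s c d. s \<notin> P \<and> c \<in> I (Suc k) \<and> d \<in> I k \<and> s * b = c + x * d" if b: "b \<in> I k" for b
  proof -
    have "b \<in> J (Suc k)"
      using k[of "Suc k"] subsetD[OF saturation_superset[OF pr(3)] subsetD[OF ideal_plus_superset b]]
      by (simp add: J_def)
    then obtain s c d where s: "s \<notin> P" "s * b = c + d * x" "c \<in> I (Suc k)"
      unfolding J_def saturation_def ideal_plus_def by blast
    have "x * d = s * b - c" using s(2) by (simp add: mult.commute)
    also have "\<dots> \<in> I k"
      using b s(3) I_anti by (intro ideal_diffD[OF Ii] ideal_multD[OF Ii]) auto
    finally have "d \<in> I k" by (rule I_divx)
    moreover have "s * b = c + x * d" using s(2) by (simp only: mult.commute[of x])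
    ultimately show ?thesis using s(1,3) by blast
  qed
  \<comment> \<open>Iteration takes the place of Nakayama's lemma: the remainder is pushed into an
    arbitrarily high power of \<open>x\<close> times \<open>I k\<close>.\<close>
  have iter: "\<exists>s c d. s \<notin> P \<and> c \<in> I (Suc k) \<and> d \<in> I k \<and> s * b = c + x ^ l * d" if "b \<in> I k" for b l
  proof (induction l)
    case 0
    show ?case using that prime_oneD[OF pr(3)] ideal_zeroD[OF Ii]
      by (intro exI[of _ 1] exI[of _ 0] exI[of _ b]) auto
  next
    case (Suc l)
    then obtain s c d where s: "s \<notin> P" "c \<in> I (Suc k)" "d \<in> I k" "s * b = c + x ^ l * d" by blast
    obtain s' c' d' where s': "s' \<notin> P" "c' \<in> I (Suc k)" "d' \<in> I k" "s' * d = c' + x * d'"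
      using step[OF s(3)] by blast
    have "s' * s * b = s' * (s * b)" by (rule mult.assoc)
    also have "\<dots> = s' * c + x ^ l * (s' * d)" unfolding s(4) by (simp add: algebra_simps)
    also have "\<dots> = (s' * c + x ^ l * c') + x ^ Suc l * d'" unfolding s'(4) by (simp add: algebra_simps)
    finally have "s' * s * b = (s' * c + x ^ l * c') + x ^ Suc l * d'" .
    moreover have "s' * c + x ^ l * c' \<in> I (Suc k)"
      by (intro ideal_addD[OF Ii] ideal_multD[OF Ii] s s')
    ultimately show ?case using mult[OF s'(1) s(1)] s'(3) by blast
  qed
  have "y ^ k \<in> I k" by (rule subsetD[OF I_base ideal_plus_self[OF P0i]])
  \<comment> \<open>The exponent is one more than \<open>L k\<close>: \<open>x ^ L k\<close> turns
    \<open>d\<close> into an element of \<open>P\<^sub>0 + (y ^ k)\<close> up to a factor outside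
    \<open>P\<close>, and the spare \<open>x\<close> keeps \<open>s' * s - x * e\<close> outside
    \<open>P\<close>.\<close>
  then obtain s c d where s: "s \<notin> P" "c \<in> I (Suc k)" "d \<in> I k" "s * y ^ k = c + x ^ Suc (L k) * d"
    using iter by blast
  obtain s' p e where s': "s' \<notin> P" "p \<in> P\<^sub>0" "s' * (x ^ L k * d) = p + e * y ^ k"
    using s(3) unfolding L M_def saturation_def ideal_plus_def by blast
  have "s' * s * y ^ k = s' * (s * y ^ k)" by (rule mult.assoc)
  also have "\<dots> = s' * c + x * (s' * (x ^ L k * d))"
    unfolding s(4) by (simp add: algebra_simps)
  finally have "s' * s * y ^ k = s' * c + x * (s' * (x ^ L k * d))" .
  then have "(s' * s - x * e) * y ^ k = s' * c + x * p"
    unfolding s'(3) by (simp add: algebra_simps)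
  also have "\<dots> \<in> I (Suc k)"
    by (intro ideal_addD[OF Ii] ideal_multD[OF Ii] s(2) subsetD[OF P0_I s'(2)])
  finally have unit_mult: "(s' * s - x * e) * y ^ k \<in> I (Suc k)" .
  have "s' * s - x * e \<notin> P"
  proof
    assume "s' * s - x * e \<in> P"
    then have "(s' * s - x * e) + x * e \<in> P"
      by (rule ideal_addD[OF prime_idealD[OF pr(3)] _ ideal_mult_rightD[OF prime_idealD[OF pr(3)] x]])
    then show False using mult[OF s'(1) s(1)] by simp
  qed
  then have "y ^ k \<in> I (Suc k)" by (rule saturatedD(2)[OF satI _ unit_mult])
  then obtain l where "y ^ k \<in> M (Suc k) l" by (auto simp: I_def)
  then obtain t where t: "t \<notin> P" "t * (x ^ l * y ^ k) \<in> ideal_plus P\<^sub>0 (y ^ Suc k)"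
    unfolding M_def by (auto elim: saturationE)
  then obtain q g where q: "q \<in> P\<^sub>0" "t * (x ^ l * y ^ k) = q + g * y ^ Suc k"
    unfolding ideal_plus_def by blast
  \<comment> \<open>The prime \<open>P\<^sub>0\<close> does not contain \<open>y\<close>, so the
    factor \<open>y ^ k\<close> can be cancelled modulo \<open>P\<^sub>0\<close>.\<close>
  have "y ^ k * (t * x ^ l - g * y) = t * (x ^ l * y ^ k) - g * y ^ Suc k"
    by (simp add: algebra_simps)
  also have "\<dots> \<in> P\<^sub>0" unfolding q(2) using q(1) by simp
  finally have "t * x ^ l - g * y \<in> P\<^sub>0"
    using prime_multD[OF pr(1)] prime_powerD[OF pr(1)] y(2) by metis
  then have "t * x ^ l - g * y \<in> Q" using psubset_imp_subset[OF strict(1)] by (rule subsetD[rotated])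
  then have "t * x ^ l - g * y + g * y \<in> Q"
    by (rule ideal_addD[OF prime_idealD[OF pr(2)] _ ideal_multD[OF prime_idealD[OF pr(2)] y(1)]])
  then have "t * x ^ l \<in> Q" by simp
  then show False
    using prime_multD[OF pr(2), of t "x ^ l"] prime_powerD[OF pr(2), of x l] t(1) strict(2) xQ by auto
qed

section \<open>Chains of primes and Krull dimension\<close>

definition prime_chain :: "nat \<Rightarrow> (nat \<Rightarrow> 'a::comm_ring_1 set) \<Rightarrow> bool" where
  "prime_chain n p \<longleftrightarrow> (\<forall>i\<le>n. primeideal (p i) type_ring) \<and> (\<forall>i<n. p i \<subset> p (Suc i))"

lemma prime_chain_extend:
  assumes "prime_chain n p" "primeideal Q type_ring" "p n \<subset> Q"
  shows "prime_chain (Suc n) (p(Suc n := Q))"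
  using assms by (auto simp: prime_chain_def less_Suc_eq le_Suc_eq)

lemma prime_chain_take: "prime_chain n p \<Longrightarrow> m \<le> n \<Longrightarrow> prime_chain m p"
  by (auto simp: prime_chain_def)

text \<open>If the last prime but one misses \<open>x\<close>, the principal ideal theorem says that
  the top prime is not minimal over \<open>x\<close> and the prime two steps below. A prime
  \<open>Q\<close> containing \<open>x\<close> therefore fits strictly between these two and
  replaces the one that misses \<open>x\<close>; the induction goes on with the chain ending in
  \<open>Q\<close>.\<close>

lemma prime_chain_through_element:
  fixes p :: "nat \<Rightarrow> 'a::comm_ring_1 set"
  assumes N: "noetherian_ring (type_ring :: 'a ring)"
    and "prime_chain (Suc n) p" "x \<in> p (Suc n)"
  obtains q where "prime_chain n q" "x \<in> q 0" "p 0 \<subseteq> q 0" "q n = p (Suc n)"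
proof -
  have "\<exists>q. prime_chain n q \<and> x \<in> q 0 \<and> p 0 \<subseteq> q 0 \<and> q n = p (Suc n)"
    using assms(2,3)
  proof (induction n arbitrary: p)
    case 0
    then show ?case by (intro exI[of _ "\<lambda>_. p 1"]) (auto simp: prime_chain_def)
  next
    case (Suc n)
    let ?P = "p (Suc (Suc n))"
    have p: "primeideal (p n) type_ring" "primeideal (p (Suc n)) type_ring"
      "primeideal ?P type_ring" "p n \<subset> p (Suc n)" "p (Suc n) \<subset> ?P"
      using Suc.prems(1) by (auto simp: prime_chain_def)
    obtain Q where Q: "primeideal Q type_ring" "x \<in> Q" "Q \<subset> ?P" "p n \<subset> Q"
    proof (cases "x \<in> p (Suc n)")
      case True
      then show ?thesis using that p by blast
    next
      case False
      obtain Q where "primeideal Q type_ring" "x \<in> Q" "Q \<subset> ?P" "p n \<subseteq> Q"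
        using krull_principal_ideal[OF N p(1-5) Suc.prems(2)] by blast
      then show ?thesis using that False p(4) by blast
    qed
    have "prime_chain (Suc n) (p(Suc n := Q))"
      using Suc.prems(1) Q by (intro prime_chain_extend[OF prime_chain_take]) auto
    from Suc.IH[OF this] obtain q where
      q: "prime_chain n q" "x \<in> q 0" "p 0 \<subseteq> q 0" "q n = Q" using Q(2) by auto
    have "prime_chain (Suc n) (q(Suc n := ?P))"
      using q Q(3) p(3) by (intro prime_chain_extend) auto
    moreover have "x \<in> (q(Suc n := ?P)) 0" "p 0 \<subseteq> (q(Suc n := ?P)) 0" "(q(Suc n := ?P)) (Suc n) = ?P"
      using q by simp_all
    ultimately show ?case by blast
  qed
  then show thesis using that by blast
qed

lemma prime_chain_through_set:
  fixes p :: "nat \<Rightarrow> 'a::comm_ring_1 set"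
  assumes N: "noetherian_ring (type_ring :: 'a ring)"
    and "finite A" "prime_chain n p" "A \<subseteq> p n" "card A \<le> n"
  shows "\<exists>q. prime_chain (n - card A) q \<and> A \<subseteq> q 0 \<and> p 0 \<subseteq> q 0 \<and> q (n - card A) = p n"
  using assms(2-)
proof (induction A rule: finite_induct)
  case empty
  then show ?case by (intro exI[of _ p]) auto
next
  case (insert x A)
  then obtain q where q: "prime_chain (n - card A) q" "A \<subseteq> q 0" "p 0 \<subseteq> q 0" "q (n - card A) = p n"
    by auto
  have m: "n - card A = Suc (n - card (insert x A))"
    using insert.prems(3) insert.hyps by simp
  obtain r where "prime_chain (n - card (insert x A)) r" "x \<in> r 0" "q 0 \<subseteq> r 0"
    "r (n - card (insert x A)) = q (n - card A)"
    using prime_chain_through_element[OF N, of "n - card (insert x A)" q x] q insert.prems(2)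
    unfolding m by auto
  then show ?case using q by (intro exI[of _ r]) auto
qed

text \<open>Krull's height theorem, for a local quotient with an ideal of definition generated by \<open>A\<close>.\<close>

lemma prime_chain_length_le:
  fixes p :: "nat \<Rightarrow> 'a::comm_ring_1 set"
  assumes N: "noetherian_ring (type_ring :: 'a ring)"
    and M: "primeideal M type_ring" "\<And>Q. primeideal Q type_ring \<Longrightarrow> I \<subseteq> Q \<Longrightarrow> Q \<subseteq> M"
    and A: "finite A" "A \<subseteq> M" "\<And>Q. primeideal Q type_ring \<Longrightarrow> I \<subseteq> Q \<Longrightarrow> A \<subseteq> Q \<Longrightarrow> Q = M"
    and p: "prime_chain n p" "I \<subseteq> p 0"
  shows "n \<le> card A"
proof (rule ccontr)
  assume n: "\<not> n \<le> card A"
  have mono: "p 0 \<subseteq> p i" if "i \<le> n" for i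
    using that
  proof (induction i)
    case (Suc i)
    then have "p i \<subset> p (Suc i)" using p(1) by (auto simp: prime_chain_def)
    then show ?case using Suc by auto
  qed simp
  \<comment> \<open>The top member is raised to \<open>M\<close>, which is known to contain
    \<open>A\<close>.\<close>
  define p' where "p' = p(n := M)"
  obtain m where m: "n = Suc m" using n by (cases n) auto
  have "p m \<subset> p (Suc m)" "primeideal (p (Suc m)) type_ring"
    using p(1) unfolding m prime_chain_def by auto
  moreover have "I \<subseteq> p (Suc m)" using p(2) mono[of n] m by auto
  ultimately have "p m \<subset> M" using M(2)[of "p (Suc m)"] by auto
  then have p': "prime_chain n p'"
    using p(1) M(1) unfolding p'_def m by (intro prime_chain_extend) (auto intro: prime_chain_take)
  obtain q where q: "prime_chain (n - card A) q" "A \<subseteq> q 0" "p' 0 \<subseteq> q 0" "q (n - card A) = p' n"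
    using prime_chain_through_set[OF N A(1) p'] A(2) n by (auto simp: p'_def)
  \<comment> \<open>As \<open>n\<close> exceeds \<open>card A\<close>, the shortened chain has at
    least two members, but its bottom contains \<open>I\<close> and \<open>A\<close> and so is
    already \<open>M\<close>.\<close>
  have q01: "primeideal (q 0) type_ring" "primeideal (q 1) type_ring" "q 0 \<subset> q 1"
    using q(1) n by (auto simp: prime_chain_def)
  have "I \<subseteq> q 0" using q(3) p(2) by (simp add: p'_def m)
  then have "q 0 = M" "q 1 \<subseteq> M" using A(3)[OF q01(1)] M(2)[OF q01(2)] q(2) q01(3) by auto
  then show False using q01(3) by auto
qed

lemma krull_dim_leI:
  assumes "\<And>n p. (\<forall>i\<le>n. primeideal (p i) R) \<Longrightarrow> (\<forall>i<n. p i \<subset> p (Suc i)) \<Longrightarrow> n \<le> d"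
  shows "krull_dim R \<le> enat d"
  unfolding krull_dim_def using assms by (intro Sup_least) auto

lemma krull_dim_geI:
  assumes "\<forall>i\<le>n. primeideal (p i) R" "\<forall>i<n. p i \<subset> p (Suc i)"
  shows "enat n \<le> krull_dim R"
  unfolding krull_dim_def using assms by (intro Sup_upper) auto

lemma krull_dim_type_ring_le:
  assumes N: "noetherian_ring (type_ring :: 'a::comm_ring_1 ring)"
    and M: "primeideal M (type_ring :: 'a ring)" "\<And>Q. primeideal Q type_ring \<Longrightarrow> Q \<subseteq> M"
    and A: "finite A" "M = Idl\<^bsub>type_ring\<^esub> A"
  shows "krull_dim (type_ring :: 'a ring) \<le> enat (card A)"
proof (rule krull_dim_leI)
  interpret ring "type_ring :: 'a ring" by (rule type_ring_ring)
  have AM: "A \<subseteq> M" using genideal_self[of A] A(2) by simp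
  fix n and p :: "nat \<Rightarrow> 'a set"
  assume p: "\<forall>i\<le>n. primeideal (p i) type_ring" "\<forall>i<n. p i \<subset> p (Suc i)"
  show "n \<le> card A"
  proof (rule prime_chain_length_le[OF N M(1) _ A(1) AM, of "{}" n p])
    show "Q = M" if "primeideal Q type_ring" "A \<subseteq> Q" for Q
      using genideal_minimal[OF prime_idealD[OF that(1)] that(2)] M(2)[OF that(1)] A(2) by auto
  qed (use M p in \<open>auto simp: prime_chain_def\<close>)
qed

text \<open>The quotient lives on cosets and not on a type, so the height bound is applied upstairs:
  primes are pulled back to primes containing \<open>I\<close>, and surjectivity of the projection
  keeps the inclusions strict.\<close>

lemma krull_dim_quotient_le:
  assumes N: "noetherian_ring (type_ring :: 'a::comm_ring_1 ring)"
    and I: "ideal I (type_ring :: 'a ring)"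
    and M: "primeideal M (type_ring :: 'a ring)" "\<And>Q. primeideal Q type_ring \<Longrightarrow> I \<subseteq> Q \<Longrightarrow> Q \<subseteq> M"
    and A: "finite A" "A \<subseteq> M" "\<And>Q. primeideal Q type_ring \<Longrightarrow> I \<subseteq> Q \<Longrightarrow> A \<subseteq> Q \<Longrightarrow> Q = M"
  shows "krull_dim (type_ring Quot I) \<le> enat (card A)"
proof (rule krull_dim_leI)
  let ?Q = "type_ring Quot I"
  let ?h = "(+>\<^bsub>type_ring\<^esub>) I"
  interpret h: ring_hom_ring type_ring ?Q ?h by (rule ideal.rcos_ring_hom_ring[OF I])
  fix n p assume p: "\<forall>i\<le>n. primeideal (p i) ?Q" "\<forall>i<n. p i \<subset> p (Suc i)"
  define q where "q i = {r. ?h r \<in> p i}" for i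
  have q: "primeideal (q i) type_ring" if "i \<le> n" for i
    using h.primeideal_vimage[OF type_ring_cring, of "p i"] p(1) that by (simp add: q_def)
  show "n \<le> card A"
  proof (rule prime_chain_length_le[OF N M A])
    have "q i \<subset> q (Suc i)" if i: "i < n" for i
    proof -
      have "p i \<subset> p (Suc i)" "p (Suc i) \<subseteq> carrier ?Q"
        using p i by (auto simp: primeideal_def ideal_def additive_subgroup.a_subset Suc_le_eq)
      then obtain z where z: "z \<in> p (Suc i)" "z \<notin> p i" "z \<in> carrier ?Q" by blast
      then obtain r where "z = ?h r" unfolding FactRing_def A_RCOSETS_def'[of type_ring I] by auto
      then have "r \<in> q (Suc i)" "r \<notin> q i" using z by (auto simp: q_def)
      moreover have "q i \<subseteq> q (Suc i)" using p(2) i by (auto simp: q_def)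
      ultimately show ?thesis by blast
    qed
    then show "prime_chain n q" using q by (simp add: prime_chain_def)
    show "I \<subseteq> q 0"
    proof
      fix r assume "r \<in> I"
      then have "?h r = \<zero>\<^bsub>?Q\<^esub>" using h.R.a_rcos_zero[OF I] by (simp add: FactRing_def)
      moreover have "\<zero>\<^bsub>?Q\<^esub> \<in> p 0"
        using p(1) by (simp add: primeideal_def ideal_def additive_subgroup.zero_closed)
      ultimately show "r \<in> q 0" by (simp add: q_def)
    qed
  qed auto
qed

section \<open>Noetherian power series rings\<close>

lemma fps_eq_const_plus_X: "f = fps_const (fps_nth f 0) + fps_X * fps_shift 1 (f :: 'a::comm_ring_1 fps)"
  by (rule fps_ext) (simp add: fps_X_mult_nth)

lemma fps_eq_X_mult_shift:
  assumes "fps_nth f 0 = (0 :: 'a::comm_ring_1)"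
  shows "f = fps_X * fps_shift 1 f"
  using fps_eq_const_plus_X[of f] assms by simp

text \<open>Each \<open>D k\<close> is divisible by every power of \<open>X\<close>. This is how an
  infinite division process is shown to leave no remainder, without any topology.\<close>

lemma fps_eq_zero_by_shifts:
  fixes D :: "nat \<Rightarrow> 'a::comm_ring_1 fps"
  assumes "\<And>k. D k = fps_X * D (Suc k)"
  shows "D k = 0"
proof -
  have "fps_nth (D k) n = 0" for n k
  proof (induction n arbitrary: k)
    case 0
    show ?case by (subst assms) simp
  next
    case (Suc n)
    then show ?case by (subst assms) (simp add: fps_X_mult_nth)
  qed
  then show ?thesis by (auto simp: fps_eq_iff)
qed

lemma noetherian_finitely_generated:
  fixes I :: "'a::comm_ring_1 set"
  assumes "noetherian_ring (type_ring :: 'a ring)" "ideal I type_ring"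
  obtains A where "finite A" "I = Idl\<^bsub>type_ring\<^esub> A"
  using noetherian_ring.finetely_gen[OF assms] by blast

lemma in_Idl: "A \<subseteq> Idl\<^bsub>type_ring\<^esub> (A :: 'a::comm_ring_1 set)"
  using ring.genideal_self[OF type_ring_ring, of A] by simp

lemma ideal_Idl: "ideal (Idl\<^bsub>type_ring\<^esub> (A :: 'a::comm_ring_1 set)) type_ring"
  using ring.genideal_ideal[OF type_ring_ring, of A] by simp

lemma Idl_subset: "ideal I type_ring \<Longrightarrow> A \<subseteq> I \<Longrightarrow> Idl\<^bsub>type_ring\<^esub> (A :: 'a::comm_ring_1 set) \<subseteq> I"
  by (rule ring.genideal_minimal[OF type_ring_ring])

text \<open>
  Hilbert's basis theorem for power series, phrased with the ideals \<open>(J : X\<^sup>n)\<close>: their ideals of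
  constant terms stabilize, at that point \<open>(J : X\<^sup>n)\<close> is generated by lifts of generators of the
  constant terms, and finite generation descends from \<open>(J : X\<^bsup>n+1\<^esup>)\<close> to \<open>(J : X\<^sup>n)\<close>.
\<close>

theorem noetherian_fps:
  assumes N: "noetherian_ring (type_ring :: 'a::comm_ring_1 ring)"
  shows "noetherian_ring (type_ring :: 'a fps ring)"
proof (rule ring.noetherian_ringI[OF type_ring_ring])
  fix J :: "'a fps set" assume J: "ideal J type_ring"
  define I where "I n = {f. fps_X ^ n * f \<in> J}" for n
  have ideal_I: "ideal (I n) type_ring" for n
    unfolding ideal_type_ring_iff I_def
    using ideal_zeroD[OF J] ideal_addD[OF J] ideal_multD[OF J]
    by (simp add: distrib_left mult.left_commute[of "fps_X ^ n"])
  have I_Suc_iff: "f \<in> I (Suc n) \<longleftrightarrow> fps_X * f \<in> I n" for f n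
    by (simp add: I_def mult.assoc mult.left_commute)
  have I_Suc: "I n \<subseteq> I (Suc n)" for n
    using ideal_multD[OF ideal_I] by (auto simp: I_Suc_iff)
  have I_mono: "I n \<subseteq> I m" if "n \<le> m" for n m using I_Suc that by (rule lift_Suc_mono_le)
  define C where "C n = (\<lambda>f. fps_nth f 0) ` I n" for n
  have ideal_C: "ideal (C n) type_ring" for n
    unfolding ideal_type_ring_iff C_def
  proof (intro conjI ballI allI)
    show "0 \<in> (\<lambda>f. fps_nth f 0) ` I n" using ideal_zeroD[OF ideal_I, of n] by force
    fix a assume "a \<in> (\<lambda>f. fps_nth f 0) ` I n"
    then obtain f where f: "f \<in> I n" "a = fps_nth f 0" by blast
    show "r * a \<in> (\<lambda>f. fps_nth f 0) ` I n" for r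
      using ideal_multD[OF ideal_I f(1), of "fps_const r"] f(2) by force
    fix b assume "b \<in> (\<lambda>f. fps_nth f 0) ` I n"
    then obtain g where g: "g \<in> I n" "b = fps_nth g 0" by blast
    show "a + b \<in> (\<lambda>f. fps_nth f 0) ` I n"
      using ideal_addD[OF ideal_I f(1) g(1)] f(2) g(2) by force
  qed
  have gens: "\<exists>G F. finite G \<and> C n = Idl\<^bsub>type_ring\<^esub> G \<and> (\<forall>g\<in>G. F g \<in> I n \<and> fps_nth (F g) 0 = g)" for n
  proof -
    obtain G where G: "finite G" "C n = Idl\<^bsub>type_ring\<^esub> G"
      by (rule noetherian_finitely_generated[OF N ideal_C])
    have "\<exists>f. f \<in> I n \<and> fps_nth f 0 = g" if "g \<in> G" for g
    proof -
      have "g \<in> C n" unfolding G(2) using that by (rule subsetD[OF in_Idl])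
      then show ?thesis by (auto simp: C_def)
    qed
    then show ?thesis using G by metis
  qed
  have remainder: "\<exists>c. f - (\<Sum>g\<in>G. fps_const (c g) * F g)
      = fps_X * fps_shift 1 (f - (\<Sum>g\<in>G. fps_const (c g) * F g))"
    if G: "finite G" "fps_nth f 0 \<in> Idl\<^bsub>type_ring\<^esub> G" "\<forall>g\<in>G. fps_nth (F g) 0 = g" for f G F
  proof -
    obtain c where "fps_nth f 0 = (\<Sum>g\<in>G. c g * g)"
      using G(2) unfolding Idl_finite[OF G(1)] by blast
    then have "fps_nth (f - (\<Sum>g\<in>G. fps_const (c g) * F g)) 0 = 0"
      using G(3) by (simp add: fps_sum_nth)
    then show ?thesis using fps_eq_X_mult_shift by blast
  qed
  have C_Suc: "C n \<subseteq> C (Suc n)" for n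
    unfolding C_def by (rule image_mono[OF I_Suc])
  obtain n0 where n0: "\<And>n. n \<ge> n0 \<Longrightarrow> C n = C n0"
    using noetherian_acc[of C, OF N ideal_C C_Suc] by blast
  define fg where "fg K \<longleftrightarrow> (\<exists>A. finite A \<and> K = Idl\<^bsub>type_ring\<^esub> A)" for K :: "'a fps set"
  have base: "fg (I n0)"
  proof -
    obtain G F where G: "finite G" "C n0 = Idl\<^bsub>type_ring\<^esub> G"
      "\<And>g. g \<in> G \<Longrightarrow> F g \<in> I n0" "\<forall>g\<in>G. fps_nth (F g) 0 = g"
      using gens[of n0] by blast
    have "\<forall>f. \<exists>c. fps_nth f 0 \<in> C n0 \<longrightarrow> f - (\<Sum>g\<in>G. fps_const (c g) * F g)
      = fps_X * fps_shift 1 (f - (\<Sum>g\<in>G. fps_const (c g) * F g))"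
      using remainder[OF G(1) _ G(4)] unfolding G(2) by blast
    then obtain c where c: "\<And>f. fps_nth f 0 \<in> C n0 \<Longrightarrow> f - (\<Sum>g\<in>G. fps_const (c f g) * F g)
      = fps_X * fps_shift 1 (f - (\<Sum>g\<in>G. fps_const (c f g) * F g))"
      by metis
    \<comment> \<open>One round of division: clear the constant term with the lifts
      \<open>F g\<close>, then divide by \<open>X\<close>.\<close>
    define next_f where "next_f f = fps_shift 1 (f - (\<Sum>g\<in>G. fps_const (c f g) * F g))" for f
    have "I n0 \<subseteq> Idl\<^bsub>type_ring\<^esub> (F ` G)"
    proof
      fix f assume f: "f \<in> I n0"
      define s where "s k = (next_f ^^ k) f" for k
      \<comment> \<open>The remainders wander through growing ideals \<open>I (n0 + k)\<close>, but
        their constant terms stay in \<open>C n0\<close> because \<open>C\<close> is stationary from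
        \<open>n0\<close> on, so the same lifts work in every round.\<close>
      have "s k \<in> I (n0 + k) \<and> s k - (\<Sum>g\<in>G. fps_const (c (s k) g) * F g) = fps_X * s (Suc k)" for k
      proof (induction k)
        have *: "h - (\<Sum>g\<in>G. fps_const (c h g) * F g) = fps_X * next_f h"
          "next_f h \<in> I (n0 + Suc k)" if h: "h \<in> I (n0 + k)" for h k
        proof -
          have "fps_nth h 0 \<in> C n0" using h n0[of "n0 + k"] by (auto simp: C_def)
          then show eq: "h - (\<Sum>g\<in>G. fps_const (c h g) * F g) = fps_X * next_f h"
            unfolding next_f_def by (rule c)
          have "F g \<in> I (n0 + k)" if "g \<in> G" for g
            using G(3)[OF that] I_mono[of n0 "n0 + k"] by auto
          then have "h - (\<Sum>g\<in>G. fps_const (c h g) * F g) \<in> I (n0 + k)"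
            by (intro ideal_diffD[OF ideal_I h] ideal_sumD[OF ideal_I] ideal_multD[OF ideal_I])
          then show "next_f h \<in> I (n0 + Suc k)" unfolding eq by (simp add: I_Suc_iff)
        qed
        case 0
        show ?case using f *[of f 0] by (simp add: s_def)
        case (Suc k)
        then show ?case using *[of "s k" k] *[of "s (Suc k)" "Suc k"] by (simp add: s_def)
      qed
      then have s: "s k - (\<Sum>g\<in>G. fps_const (c (s k) g) * F g) = fps_X * s (Suc k)" for k by blast
      \<comment> \<open>\<open>H 0 g\<close> collects into one power series the constants by which
        \<open>F g\<close> is multiplied in the successive rounds; \<open>H k g\<close> is its tail
        from round \<open>k\<close>.\<close>
      define H where "H k g = Abs_fps (\<lambda>j. c (s (k + j)) g)" for k g
      have H: "H k g = fps_const (c (s k) g) + fps_X * H (Suc k) g" for k g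
        by (rule fps_ext) (auto simp: H_def fps_X_mult_nth)
      define D where "D k = s k - (\<Sum>g\<in>G. H k g * F g)" for k
      have "D k = fps_X * D (Suc k)" for k
      proof -
        have "D k = (s k - (\<Sum>g\<in>G. fps_const (c (s k) g) * F g)) - fps_X * (\<Sum>g\<in>G. H (Suc k) g * F g)"
          unfolding D_def by (subst H) (simp add: sum.distrib distrib_right sum_distrib_left mult.assoc)
        then show ?thesis unfolding s by (simp add: D_def right_diff_distrib)
      qed
      then have "D 0 = 0" by (rule fps_eq_zero_by_shifts)
      then have "f = (\<Sum>g\<in>G. H 0 g * F g)" by (simp add: D_def s_def)
      also have "\<dots> \<in> Idl\<^bsub>type_ring\<^esub> (F ` G)"
        by (intro ideal_sumD[OF ideal_Idl] ideal_multD[OF ideal_Idl] subsetD[OF in_Idl]) simp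
      finally show "f \<in> Idl\<^bsub>type_ring\<^esub> (F ` G)" .
    qed
    moreover have "Idl\<^bsub>type_ring\<^esub> (F ` G) \<subseteq> I n0"
      using G(3) by (intro Idl_subset[OF ideal_I]) auto
    ultimately show ?thesis unfolding fg_def using G(1) by (intro exI[of _ "F ` G"]) auto
  qed
  have descend: "fg (I n)" if fg_Suc: "fg (I (Suc n))" for n
  proof -
    obtain B where B: "finite B" "I (Suc n) = Idl\<^bsub>type_ring\<^esub> B" using fg_Suc fg_def by auto
    obtain G F where G: "finite G" "C n = Idl\<^bsub>type_ring\<^esub> G"
      "\<And>g. g \<in> G \<Longrightarrow> F g \<in> I n" "\<forall>g\<in>G. fps_nth (F g) 0 = g"
      using gens[of n] by blast
    let ?A = "F ` G \<union> (\<lambda>b. fps_X * b) ` B"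
    have "f \<in> Idl\<^bsub>type_ring\<^esub> ?A" if f: "f \<in> I n" for f
    proof -
      have "fps_nth f 0 \<in> Idl\<^bsub>type_ring\<^esub> G" using f G(2) by (auto simp: C_def)
      then obtain c r where r: "f - (\<Sum>g\<in>G. fps_const (c g) * F g) = fps_X * r"
        using remainder[OF G(1) _ G(4)] by blast
      have "f - (\<Sum>g\<in>G. fps_const (c g) * F g) \<in> I n"
        using G(3) by (intro ideal_diffD[OF ideal_I f] ideal_sumD[OF ideal_I] ideal_multD[OF ideal_I])
      then have "r \<in> I (Suc n)" unfolding I_Suc_iff r .
      then obtain d where d: "r = (\<Sum>b\<in>B. d b * b)" unfolding B(2) Idl_finite[OF B(1)] by blast
      have "f = (\<Sum>g\<in>G. fps_const (c g) * F g) + fps_X * r" using r by (simp add: algebra_simps)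
      also have "fps_X * r = (\<Sum>b\<in>B. d b * (fps_X * b))"
        unfolding d by (simp add: sum_distrib_left mult.left_commute)
      also have "(\<Sum>g\<in>G. fps_const (c g) * F g) + \<dots> \<in> Idl\<^bsub>type_ring\<^esub> ?A"
        by (intro ideal_addD[OF ideal_Idl] ideal_sumD[OF ideal_Idl] ideal_multD[OF ideal_Idl]
            subsetD[OF in_Idl]) auto
      finally show ?thesis .
    qed
    moreover have "fps_X * b \<in> I n" if "b \<in> B" for b
      using in_Idl[of B] that B(2) I_Suc_iff by blast
    then have "Idl\<^bsub>type_ring\<^esub> ?A \<subseteq> I n" using G(3) by (intro Idl_subset[OF ideal_I]) auto
    ultimately show ?thesis unfolding fg_def using B(1) G(1) by (intro exI[of _ ?A]) auto
  qed
  have "fg (I 0)"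
    using le0[of n0] by (induction rule: inc_induct) (auto intro: base descend)
  moreover have "I 0 = J" by (simp add: I_def)
  ultimately show "\<exists>A\<subseteq>carrier type_ring. finite A \<and> J = Idl\<^bsub>type_ring\<^esub> A" by (auto simp: fg_def)
qed

section \<open>Complete regular local rings and power series\<close>

abbreviation ideal_power :: "'a::comm_ring_1 set \<Rightarrow> nat \<Rightarrow> 'a set" where
  "ideal_power I n \<equiv> I [^]\<^bsub>ideals_set type_ring\<^esub> n"

lemma ideals_set_simps [simp]:
  "\<one>\<^bsub>ideals_set type_ring\<^esub> = UNIV"
  "I \<otimes>\<^bsub>ideals_set type_ring\<^esub> J = ideal_prod type_ring I J"
  by (simp_all add: ideals_set_def)

lemma ideal_power_Suc: "ideal_power I (Suc n) = ideal_prod type_ring (ideal_power I n) I"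
  by simp

lemma ideal_prod_subsetI:
  assumes "ideal K type_ring" "\<And>a b. a \<in> I \<Longrightarrow> b \<in> J \<Longrightarrow> a * b \<in> (K :: 'a::comm_ring_1 set)"
  shows "ideal_prod type_ring I J \<subseteq> K"
proof
  fix x assume "x \<in> ideal_prod type_ring I J"
  then show "x \<in> K"
    by induction (use assms(2) ideal_addD[OF assms(1)] in auto)
qed

lemma ideal_prod_mult: "a \<in> I \<Longrightarrow> b \<in> J \<Longrightarrow> (a * b :: 'a::comm_ring_1) \<in> ideal_prod type_ring I J"
  using ideal_prod.prod[of a I b J type_ring] by simp

lemma ideal_ideal_power:
  assumes "ideal (I :: 'a::comm_ring_1 set) type_ring"
  shows "ideal (ideal_power I n) type_ring"
proof (induction n)
  case 0
  show ?case by (simp add: ideal_type_ring_iff)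
next
  case (Suc n)
  then show ?case using ring.ideal_prod_is_ideal[OF type_ring_ring _ assms] by simp
qed

lemma ideal_power_Suc_subset:
  assumes "ideal (I :: 'a::comm_ring_1 set) type_ring"
  shows "ideal_power I (Suc n) \<subseteq> ideal_power I n"
  unfolding ideal_power_Suc
  by (intro ideal_prod_subsetI ideal_ideal_power[OF assms] ideal_mult_rightD[OF ideal_ideal_power[OF assms]])

lemma ideal_power_antimono:
  assumes "ideal (I :: 'a::comm_ring_1 set) type_ring" "m \<le> n"
  shows "ideal_power I n \<subseteq> ideal_power I m"
  using ideal_power_Suc_subset[OF assms(1)] assms(2) by (rule lift_Suc_antimono_le)

text \<open>For an ideal \<open>I\<close> this is the ideal generated by \<open>I\<close> and
  \<open>X\<close>, the preimage of \<open>I\<close> under evaluation at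
  \<open>X = 0\<close>.\<close>

definition fps_ideal :: "'a::comm_ring_1 set \<Rightarrow> 'a fps set" where
  "fps_ideal I = {f. fps_nth f 0 \<in> I}"

lemma ideal_fps_ideal:
  assumes "ideal I type_ring"
  shows "ideal (fps_ideal I) type_ring"
  using assms by (simp add: ideal_type_ring_iff fps_ideal_def)

lemma primeideal_fps_ideal:
  assumes "primeideal I type_ring"
  shows "primeideal (fps_ideal I) type_ring"
  using assms ideal_fps_ideal[of I] unfolding primeideal_type_ring_iff by (auto simp: fps_ideal_def)

lemma fps_ideal_Idl:
  "fps_ideal (Idl\<^bsub>type_ring\<^esub> A) = Idl\<^bsub>type_ring\<^esub> (insert fps_X (fps_const ` (A :: 'a::comm_ring_1 set)))"
  (is "?L = Idl\<^bsub>type_ring\<^esub> ?B")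
proof
  show "Idl\<^bsub>type_ring\<^esub> ?B \<subseteq> ?L"
    using in_Idl[of A] ideal_zeroD[OF ideal_Idl, of A]
    by (intro Idl_subset ideal_fps_ideal ideal_Idl) (auto simp: fps_ideal_def)
  have "ideal {a. fps_const a \<in> Idl\<^bsub>type_ring\<^esub> ?B} type_ring"
    unfolding ideal_type_ring_iff
    using ideal_zeroD[OF ideal_Idl, of ?B] ideal_addD[OF ideal_Idl, of _ ?B] ideal_multD[OF ideal_Idl, of _ ?B]
    by (auto simp flip: fps_const_add fps_const_mult)
  then have "Idl\<^bsub>type_ring\<^esub> A \<subseteq> {a. fps_const a \<in> Idl\<^bsub>type_ring\<^esub> ?B}"
    using in_Idl[of ?B] by (intro Idl_subset) auto
  then have "fps_const (fps_nth f 0) + fps_X * fps_shift 1 f \<in> Idl\<^bsub>type_ring\<^esub> ?B" if "f \<in> ?L" for f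
    using that in_Idl[of ?B]
    by (intro ideal_addD[OF ideal_Idl] ideal_mult_rightD[OF ideal_Idl]) (auto simp: fps_ideal_def)
  then show "?L \<subseteq> Idl\<^bsub>type_ring\<^esub> ?B" unfolding fps_eq_const_plus_X[symmetric] by blast
qed

lemma fps_const_in_ideal_power:
  "a \<in> ideal_power I n \<Longrightarrow> fps_const (a :: 'a::comm_ring_1) \<in> ideal_power (fps_ideal I) n"
proof (induction n arbitrary: a)
  case (Suc n)
  from Suc.prems[unfolded ideal_power_Suc] show ?case
  proof induction
    case (prod i j)
    then have "fps_const i * fps_const j \<in> ideal_power (fps_ideal I) (Suc n)"
      unfolding ideal_power_Suc by (intro ideal_prod_mult Suc.IH) (auto simp: fps_ideal_def)
    then show ?case by simp
  next
    case (sum s t)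
    from ideal_prod.sum[OF this(3,4)[unfolded ideal_power_Suc]] show ?case by simp
  qed
qed simp

text \<open>A power of \<open>X\<close> pays for missing factors from \<open>I\<close>. Multiplying
  by \<open>g\<close> with constant term in \<open>I\<close>, the summand \<open>i = j\<close> gains
  a factor from \<open>I\<close>, while for \<open>i < j\<close> the coefficient of \<open>f\<close>
  already lies in a high enough power. Conversely, \<open>f\<close> is its constant term plus
  \<open>X\<close> times its shift, and the shift satisfies the condition for the next lower
  exponent.\<close>

lemma ideal_power_fps_ideal:
  assumes I: "ideal (I :: 'a::comm_ring_1 set) type_ring"
  shows "ideal_power (fps_ideal I) n = {f. \<forall>j<n. fps_nth f j \<in> ideal_power I (n - j)}"
proof
  have ideal_coeffs: "ideal {f. \<forall>j<n. fps_nth f j \<in> ideal_power I (n - j)} type_ring" for n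
    unfolding ideal_type_ring_iff
  proof (safe)
    note Ip = ideal_ideal_power[OF I]
    fix f g :: "'a fps" and r j
    assume j: "j < n" and f: "\<forall>j<n. fps_nth f j \<in> ideal_power I (n - j)"
    {
      assume g: "\<forall>j<n. fps_nth g j \<in> ideal_power I (n - j)"
      show "fps_nth (f + g) j \<in> ideal_power I (n - j)"
        using f g j by (simp add: ideal_addD[OF Ip])
    }
    have "fps_nth f (j - i) \<in> ideal_power I (n - j)" if "i \<le> j" for i
    proof -
      have "fps_nth f (j - i) \<in> ideal_power I (n - (j - i))" using f j by simp
      then show ?thesis using ideal_power_antimono[OF I, of "n - j" "n - (j - i)"] by (meson diff_le_mono2 diff_le_self subsetD)
    qed
    then show "fps_nth (r * f) j \<in> ideal_power I (n - j)"
      unfolding fps_mult_nth by (intro ideal_sumD[OF Ip] ideal_multD[OF Ip]) auto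
  qed (simp add: ideal_zeroD[OF ideal_ideal_power[OF I]])
  show "ideal_power (fps_ideal I) n \<subseteq> {f. \<forall>j<n. fps_nth f j \<in> ideal_power I (n - j)}"
  proof (induction n)
    case (Suc n)
    show ?case unfolding ideal_power_Suc[of "fps_ideal I"]
    proof (rule ideal_prod_subsetI[OF ideal_coeffs], safe)
      fix f g j assume f: "f \<in> ideal_power (fps_ideal I) n" and g: "g \<in> fps_ideal I" and j: "j < Suc n"
      have f': "fps_nth f i \<in> ideal_power I (n - i)" if "i < n" for i using Suc f that by auto
      have "fps_nth f i * fps_nth g (j - i) \<in> ideal_power I (Suc n - j)" if i: "i \<le> j" for i
      proof (cases "i = j")
        case True
        have "fps_nth f j * fps_nth g 0 \<in> ideal_power I (Suc (n - j))"
          unfolding ideal_power_Suc using f'[of j] g j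
          by (intro ideal_prod_mult) (cases "j = n", auto simp: fps_ideal_def)
        then show ?thesis using True j by (simp add: Suc_diff_le)
      next
        case False
        have "fps_nth f i \<in> ideal_power I (Suc n - j)"
        proof -
          have "i < n" "Suc n - j \<le> n - i" using False i j by auto
          then show ?thesis using f'[of i] ideal_power_antimono[OF I, of "Suc n - j" "n - i"] by blast
        qed
        then show ?thesis by (rule ideal_mult_rightD[OF ideal_ideal_power[OF I]])
      qed
      then show "fps_nth (f * g) j \<in> ideal_power I (Suc n - j)"
        unfolding fps_mult_nth by (intro ideal_sumD[OF ideal_ideal_power[OF I]]) auto
    qed
  qed simp
  show "{f. \<forall>j<n. fps_nth f j \<in> ideal_power I (n - j)} \<subseteq> ideal_power (fps_ideal I) n"
  proof (induction n)
    case (Suc n)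
    show ?case
    proof safe
      fix f assume f: "\<forall>j<Suc n. fps_nth f j \<in> ideal_power I (Suc n - j)"
      have "fps_shift 1 f \<in> ideal_power (fps_ideal I) n"
        using f by (intro subsetD[OF Suc]) auto
      then have "fps_shift 1 f * fps_X \<in> ideal_power (fps_ideal I) (Suc n)"
        unfolding ideal_power_Suc using ideal_zeroD[OF I]
        by (intro ideal_prod_mult) (auto simp: fps_ideal_def)
      moreover have "fps_const (fps_nth f 0) \<in> ideal_power (fps_ideal I) (Suc n)"
        using f by (intro fps_const_in_ideal_power) (metis diff_zero zero_less_Suc)
      ultimately have "fps_const (fps_nth f 0) + fps_shift 1 f * fps_X \<in> ideal_power (fps_ideal I) (Suc n)"
        by (intro ideal_addD[OF ideal_ideal_power[OF ideal_fps_ideal[OF I]]])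
      then show "f \<in> ideal_power (fps_ideal I) (Suc n)"
        using fps_eq_const_plus_X[of f] by (simp add: mult.commute)
    qed
  qed simp
qed

lemma adically_complete_fps:
  assumes I: "ideal (I :: 'a::comm_ring_1 set) type_ring"
    and complete: "adically_complete type_ring I"
  shows "adically_complete type_ring (fps_ideal I)"
  unfolding adically_complete_def
proof (intro conjI allI impI)
  show "(\<Inter>n. ideal_power (fps_ideal I) n) = {\<zero>\<^bsub>type_ring\<^esub>}"
  proof (intro equalityI subsetI)
    fix f assume "f \<in> (\<Inter>n. ideal_power (fps_ideal I) n)"
    then have f: "fps_nth f j \<in> ideal_power I (n - j)" if "j < n" for n j
      using that by (auto simp: ideal_power_fps_ideal[OF I])
    have "fps_nth f j \<in> ideal_power I n" for j n
    proof (cases n)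
      case (Suc m)
      then show ?thesis using f[of j "n + j"] by simp
    qed simp
    then have "fps_nth f j = 0" for j using complete unfolding adically_complete_def by auto
    then show "f \<in> {\<zero>\<^bsub>type_ring\<^esub>}" by (simp add: fps_eq_iff)
  next
    fix f :: "'a fps" assume "f \<in> {\<zero>\<^bsub>type_ring\<^esub>}"
    then show "f \<in> (\<Inter>n. ideal_power (fps_ideal I) n)"
      using ideal_zeroD[OF ideal_ideal_power[OF ideal_fps_ideal[OF I]]] by simp
  qed
  fix s :: "nat \<Rightarrow> 'a fps"
  assume "\<forall>n. s n \<in> carrier type_ring \<and> s (Suc n) \<ominus>\<^bsub>type_ring\<^esub> s n \<in> ideal_power (fps_ideal I) n"
  then have s: "fps_nth (s (Suc n)) j - fps_nth (s n) j \<in> ideal_power I (n - j)" if "j < n" for n j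
    using that by (auto simp: ideal_power_fps_ideal[OF I])
  \<comment> \<open>Coefficient \<open>j\<close> of \<open>s n\<close> is controlled only modulo the
    power \<open>n - j\<close> of \<open>I\<close>; starting the sequence at \<open>s j\<close>
    compensates for the loss.\<close>
  have "\<exists>l. \<forall>n. l - fps_nth (s (n + j)) j \<in> ideal_power I n" for j
  proof -
    have "fps_nth (s (Suc n + j)) j - fps_nth (s (n + j)) j \<in> ideal_power I n" for n
      using s[of j "n + j"] by (cases n) auto
    then show ?thesis
      using complete unfolding adically_complete_def
      by (elim conjE allE[of _ "\<lambda>n. fps_nth (s (n + j)) j"]) simp
  qed
  then obtain l where l: "\<And>j n. l j - fps_nth (s (n + j)) j \<in> ideal_power I n" by metis
  have "Abs_fps l - s n \<in> ideal_power (fps_ideal I) n" for n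
    unfolding ideal_power_fps_ideal[OF I]
  proof safe
    fix j assume "j < n"
    then show "fps_nth (Abs_fps l - s n) j \<in> ideal_power I (n - j)" using l[of j "n - j"] by simp
  qed
  then show "\<exists>l\<in>carrier type_ring. \<forall>n. l \<ominus>\<^bsub>type_ring\<^esub> s n \<in> ideal_power (fps_ideal I) n"
    by (intro bexI[of _ "Abs_fps l"]) auto
qed

section \<open>Local rings and the inheritance of regularity by power series\<close>

lemma nonunits_local:
  fixes M :: "'a::comm_ring_1 set"
  assumes M: "ideal M type_ring" "1 \<notin> M" "\<forall>a. a \<notin> M \<longrightarrow> (\<exists>b. a * b = 1)"
  shows "maximalideal M type_ring" "local_ring (type_ring :: 'a ring)"
    "max_ideal (type_ring :: 'a ring) = M" "primeideal M type_ring"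
    "ideal I type_ring \<Longrightarrow> 1 \<notin> I \<Longrightarrow> I \<subseteq> M"
proof -
  have sub: "I \<subseteq> M" if I: "ideal I type_ring" "1 \<notin> I" for I
  proof
    fix a assume "a \<in> I"
    show "a \<in> M"
    proof (rule ccontr)
      assume "a \<notin> M"
      then obtain b where "a * b = 1" using M(3) by blast
      then show False using ideal_mult_rightD[OF I(1) \<open>a \<in> I\<close>, of b] I(2) by simp
    qed
  qed
  then show "ideal I type_ring \<Longrightarrow> 1 \<notin> I \<Longrightarrow> I \<subseteq> M" .
  show max: "maximalideal M type_ring"
  proof (rule maximalidealI[OF M(1)])
    show "carrier type_ring \<noteq> M" using M(2) by auto
    show "J = M \<or> J = carrier type_ring" if "ideal J type_ring" "M \<subseteq> J" for J
      using sub[OF that(1)] that(2) ideal_eq_UNIV_iff[OF that(1)] by auto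
  qed
  have uniq: "K = M" if "maximalideal K type_ring" for K
  proof -
    have K: "ideal K type_ring" using that by (rule maximalideal.axioms(1))
    then have "1 \<notin> K" using maximalideal.I_notcarr[OF that] ideal_eq_UNIV_iff[OF K] by auto
    then show ?thesis
      using maximalideal.I_maximal[OF that M(1)] sub[OF K] M(2) by auto
  qed
  show "local_ring (type_ring :: 'a ring)"
    unfolding local_ring_def using max uniq type_ring_cring by blast
  show "max_ideal (type_ring :: 'a ring) = M"
    unfolding max_ideal_def using max uniq by (rule the_equality)
  show "primeideal M type_ring"
    by (rule cring.maximalideal_prime[OF type_ring_cring max])
qed

text \<open>The induction hypothesis for adjoining a variable. The dimension enters through
  witnesses only: \<open>d\<close> generators bound it above by Krull's theorem and the chain of
  length \<open>d\<close> bounds it below. Both pass easily to power series.\<close>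

definition complete_regular_data :: "nat \<Rightarrow> 'a::idom set \<Rightarrow> bool" where
  "complete_regular_data d M \<longleftrightarrow> noetherian_ring (type_ring :: 'a ring) \<and>
     ideal M type_ring \<and> 1 \<notin> M \<and> (\<forall>a. a \<notin> M \<longrightarrow> (\<exists>b. a * b = 1)) \<and>
     (\<exists>A. finite A \<and> card A = d \<and> M = Idl\<^bsub>type_ring\<^esub> A) \<and> (\<exists>p :: nat \<Rightarrow> 'a set. prime_chain d p) \<and>
     adically_complete type_ring M"

lemma complete_regular_data_imp:
  assumes "complete_regular_data d (M :: 'a::idom set)"
  shows "complete_regular_local_ring (type_ring :: 'a ring)"
proof -
  have N: "noetherian_ring (type_ring :: 'a ring)" and M: "ideal M type_ring" "1 \<notin> M"
    "\<forall>a. a \<notin> M \<longrightarrow> (\<exists>b. a * b = 1)" and complete: "adically_complete type_ring M"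
    using assms by (auto simp: complete_regular_data_def)
  obtain A where A: "finite A" "card A = d" "M = Idl\<^bsub>type_ring\<^esub> A"
    using assms by (auto simp: complete_regular_data_def)
  obtain p where p: "prime_chain d (p :: nat \<Rightarrow> 'a set)" using assms by (auto simp: complete_regular_data_def)
  note loc = nonunits_local[OF M]
  have "krull_dim (type_ring :: 'a ring) \<le> enat d"
    using krull_dim_type_ring_le[OF N loc(4) _ A(1,3)] loc(5) unfolding primeideal_type_ring_iff A(2) by blast
  moreover have "enat d \<le> krull_dim (type_ring :: 'a ring)"
    using p by (intro krull_dim_geI[of _ p]) (auto simp: prime_chain_def)
  ultimately have "krull_dim (type_ring :: 'a ring) = enat d" by (rule antisym)
  moreover have "max_ideal (type_ring :: 'a ring) = Idl\<^bsub>type_ring\<^esub> A"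
    unfolding A(3)[symmetric] by (rule loc(3))
  ultimately have "regular_local_ring (type_ring :: 'a ring)"
    unfolding regular_local_ring_def using N loc(2) A(1,2) by auto
  then show ?thesis using complete by (simp add: complete_regular_local_ring_def loc(3))
qed

lemma complete_regular_data_fps:
  assumes "complete_regular_data d (M :: 'a::idom set)"
  shows "complete_regular_data (Suc d) (fps_ideal M)"
proof -
  have N: "noetherian_ring (type_ring :: 'a ring)" and M: "ideal M type_ring" "1 \<notin> M"
    "\<forall>a. a \<notin> M \<longrightarrow> (\<exists>b. a * b = 1)" and complete: "adically_complete type_ring M"
    using assms by (auto simp: complete_regular_data_def)
  obtain A where A: "finite A" "card A = d" "M = Idl\<^bsub>type_ring\<^esub> A"
    using assms by (auto simp: complete_regular_data_def)
  obtain p where p: "prime_chain d (p :: nat \<Rightarrow> 'a set)" using assms by (auto simp: complete_regular_data_def)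
  have "\<exists>g. f * g = 1" if "f \<notin> fps_ideal M" for f
    using M(3)[rule_format, of "fps_nth f 0"] that fps_right_inverse[of f] by (auto simp: fps_ideal_def)
  moreover have "\<exists>B. finite B \<and> card B = Suc d \<and> fps_ideal M = Idl\<^bsub>type_ring\<^esub> B"
  proof (intro exI conjI)
    \<comment> \<open>The number of generators must go up by exactly one, so \<open>X\<close> has to
      differ from all the constants.\<close>
    have "fps_nth fps_X 1 \<noteq> fps_nth (fps_const a) 1" for a :: 'a by simp
    then have "fps_X \<noteq> fps_const a" for a :: 'a by metis
    then have "fps_X \<notin> fps_const ` A" by auto
    moreover have "inj_on fps_const A" by (auto simp: inj_on_def)
    ultimately show "card (insert fps_X (fps_const ` A)) = Suc d"
      using A(1,2) by (simp add: card_image)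
    show "fps_ideal M = Idl\<^bsub>type_ring\<^esub> (insert fps_X (fps_const ` A))" unfolding A(3) by (rule fps_ideal_Idl)
  qed (use A in simp)
  moreover have "\<exists>q. prime_chain (Suc d) (q :: nat \<Rightarrow> 'a fps set)"
  proof (intro exI)
    \<comment> \<open>Every lifted prime contains \<open>X\<close>, which leaves room for the zero
      ideal underneath; that ideal is prime since the ring is a domain.\<close>
    let ?q = "\<lambda>i. case i of 0 \<Rightarrow> {0} | Suc i \<Rightarrow> fps_ideal (p i)"
    have prime: "primeideal (?q i) type_ring" if "i \<le> Suc d" for i
    proof (cases i)
      case 0
      then show ?thesis by (simp add: primeideal_type_ring_iff ideal_type_ring_iff)
    next
      case (Suc j)
      then show ?thesis using that p by (auto simp: prime_chain_def intro: primeideal_fps_ideal)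
    qed
    have strict: "?q i \<subset> ?q (Suc i)" if i: "i < Suc d" for i
    proof (cases i)
      case 0
      have "0 \<in> p 0" using p ideal_zeroD[OF prime_idealD, of "p 0"] by (auto simp: prime_chain_def)
      then have "{0, fps_X} \<subseteq> fps_ideal (p 0)" by (auto simp: fps_ideal_def)
      moreover have "fps_X \<notin> {0 :: 'a fps}" by simp
      ultimately have "{0} \<subset> fps_ideal (p 0)" by blast
      then show ?thesis using 0 by simp
    next
      case (Suc j)
      then have "p j \<subset> p (Suc j)" using i p by (auto simp: prime_chain_def)
      then obtain a where "a \<in> p (Suc j)" "a \<notin> p j" "p j \<subseteq> p (Suc j)" by blast
      then have "fps_const a \<in> ?q (Suc i)" "fps_const a \<notin> ?q i" "?q i \<subseteq> ?q (Suc i)"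
        using Suc by (auto simp: fps_ideal_def)
      then show ?thesis by blast
    qed
    show "prime_chain (Suc d) ?q" unfolding prime_chain_def using prime strict by blast
  qed
  ultimately show ?thesis
    unfolding complete_regular_data_def
    using noetherian_fps[OF N] ideal_fps_ideal[OF M(1)] M(2) adically_complete_fps[OF M(1) complete]
    by (simp add: fps_ideal_def)
qed

section \<open>The 2-adic integers\<close>

lemma Rep_padic2_range: "0 \<le> Rep_padic2 a n" "Rep_padic2 a n < 2 ^ n"
  using Rep_padic2[of a] by auto

lemma Rep_padic2_mod: "Rep_padic2 a (m + k) mod 2 ^ m = Rep_padic2 a m"
  using padic2_mod_le[of "Rep_padic2 a" m k] Rep_padic2[of a] by simp

lemma padic2_eqI: "(\<And>n. Rep_padic2 a n = Rep_padic2 b n) \<Longrightarrow> a = b"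
  by (simp add: Rep_padic2_inject[symmetric] fun_eq_iff)

lemma Rep_padic2_of_nat: "Rep_padic2 (of_nat k) n = int k mod 2 ^ n"
  by (induction k)
    (simp_all add: zero_padic2.rep_eq plus_padic2.rep_eq one_padic2.rep_eq mod_simps)

lemma Rep_padic2_0 [simp]: "Rep_padic2 a 0 = 0"
  using Rep_padic2_range[of a 0] by simp

lemma of_nat_padic2_neq_0:
  assumes "0 < n" shows "(of_nat n :: padic2) \<noteq> 0"
proof
  assume "(of_nat n :: padic2) = 0"
  then have "int n mod 2 ^ n = 0"
    using Rep_padic2_of_nat[of n n] by (simp add: zero_padic2.rep_eq)
  moreover have "int n < 2 ^ n" using of_nat_less_two_power[of n, where 'a = int] .
  ultimately show False using assms by simp
qed

text \<open>Halving costs one digit: the residue of \<open>b\<close> modulo \<open>2 ^ n\<close> is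
  half of the residue of \<open>a\<close> modulo \<open>2 ^ Suc n\<close>. Exposing these residues
  lets the halving be repeated for higher powers of 2.\<close>

lemma padic2_halve:
  assumes "Rep_padic2 a 1 = 0"
  shows "\<exists>b. a = 2 * b \<and> (\<forall>n. Rep_padic2 b n = Rep_padic2 a (Suc n) div 2)"
proof -
  have div2: "2 * t + x mod 2 = r \<Longrightarrow> t = r div 2" for t x r :: int by presburger
  define f where "f n = Rep_padic2 a (Suc n) div 2" for n
  have f: "\<forall>n. f n \<in> {0..<2 ^ n} \<and> f (Suc n) mod 2 ^ n = f n"
  proof safe
    fix n
    show "f n \<in> {0..<2 ^ n}" using Rep_padic2_range[of a "Suc n"] by (simp add: f_def)
    have "2 * (Rep_padic2 a (Suc (Suc n)) div 2 mod 2 ^ n) + Rep_padic2 a (Suc (Suc n)) mod 2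
        = Rep_padic2 a (Suc (Suc n)) mod 2 ^ Suc n"
      by (simp add: zmod_zmult2_eq)
    also have "\<dots> = Rep_padic2 a (Suc n)" using Rep_padic2_mod[of a "Suc n" 1] by simp
    finally show "f (Suc n) mod 2 ^ n = f n" unfolding f_def by (rule div2)
  qed
  define b where "b = Abs_padic2 f"
  have b: "Rep_padic2 b = f" unfolding b_def using f by (intro Abs_padic2_inverse) simp
  have "a = 2 * b"
  proof (rule padic2_eqI)
    fix n
    have "Rep_padic2 a (Suc n) mod 2 = 0"
      using Rep_padic2_mod[of a 1 n] assms by simp
    then have "2 * f n = Rep_padic2 a (Suc n)" unfolding f_def by presburger
    moreover have "Rep_padic2 (2 * b) n = 2 * f n mod 2 ^ n"
      using Rep_padic2_of_nat[of 2 n] by (simp add: times_padic2.rep_eq b mod_simps)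
    ultimately show "Rep_padic2 a n = Rep_padic2 (2 * b) n"
      using Rep_padic2_mod[of a n 1] by simp
  qed
  then show ?thesis using b f_def by auto
qed

lemma two_power_dvd_padic2_iff: "2 ^ n dvd a \<longleftrightarrow> Rep_padic2 a n = 0"
proof
  assume "2 ^ n dvd a"
  then obtain b where "a = 2 ^ n * b" by (elim dvdE)
  then show "Rep_padic2 a n = 0"
    using Rep_padic2_of_nat[of "2 ^ n" n] by (simp add: times_padic2.rep_eq)
next
  show "Rep_padic2 a n = 0 \<Longrightarrow> 2 ^ n dvd a"
  proof (induction n arbitrary: a)
    case (Suc n)
    then have "Rep_padic2 a 1 = 0" using Rep_padic2_mod[of a 1 n] by simp
    then obtain b where b: "a = 2 * b" "\<forall>n. Rep_padic2 b n = Rep_padic2 a (Suc n) div 2"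
      using padic2_halve by blast
    then have "2 ^ n dvd b" using Suc by simp
    then show ?case using b(1) by (simp add: mult_dvd_mono)
  qed simp
qed

text \<open>Inverses modulo each \<open>2 ^ n\<close> are chosen independently by Bezout; they form
  a compatible sequence because an inverse modulo \<open>2 ^ n\<close> is unique. Writing
  \<open>1 mod 2 ^ n\<close> covers the modulus 1 at \<open>n = 0\<close>.\<close>

lemma padic2_odd_unit:
  assumes "Rep_padic2 a 1 \<noteq> 0"
  obtains b where "a * b = 1"
proof -
  have "odd (Rep_padic2 a (Suc n))" for n
  proof
    assume "even (Rep_padic2 a (Suc n))"
    then show False using Rep_padic2_mod[of a 1 n] assms by simp
  qed
  then have "coprime (Rep_padic2 a n) (2 ^ n)" for n by (cases n) auto
  then have "\<exists>x. (Rep_padic2 a n * x) mod 2 ^ n = 1 mod 2 ^ n" for n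
    using bezout_int[of "Rep_padic2 a n" "2 ^ n"]
    by (metis coprime_imp_gcd_eq_1 mod_mult_self1 mult.commute)
  then obtain g where g: "\<And>n. (Rep_padic2 a n * g n) mod 2 ^ n = 1 mod 2 ^ n" by metis
  define f where "f n = g n mod 2 ^ n" for n
  have f: "(Rep_padic2 a n * f n) mod 2 ^ n = 1 mod 2 ^ n" for n
    using g[of n] by (simp add: f_def mod_simps)
  have "f (Suc n) mod 2 ^ n = f n" for n
  proof -
    let ?m = "2 ^ n :: int" and ?A = "Rep_padic2 a (Suc n)"
    have A: "?A mod ?m = Rep_padic2 a n" using Rep_padic2_mod[of a n 1] by simp
    have "(?A * f (Suc n)) mod 2 ^ Suc n mod ?m = 1 mod 2 ^ Suc n mod ?m" by (simp only: f)
    then have "(?A * f (Suc n)) mod ?m = 1 mod ?m" by (simp only: mod_Suc_pow2)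
    then have inv: "(Rep_padic2 a n * f (Suc n)) mod ?m = 1 mod ?m"
      unfolding A[symmetric] by (simp add: mod_simps)
    have "f (Suc n) mod ?m = (f (Suc n) * ((Rep_padic2 a n * f n) mod ?m)) mod ?m"
      unfolding f by (simp add: mod_simps)
    also have "\<dots> = (f n * ((Rep_padic2 a n * f (Suc n)) mod ?m)) mod ?m"
      by (simp add: mod_simps ac_simps)
    also have "\<dots> = f n mod ?m" unfolding inv by (simp add: mod_simps)
    finally show ?thesis by (simp add: f_def)
  qed
  then have "\<forall>n. f n \<in> {0..<2 ^ n} \<and> f (Suc n) mod 2 ^ n = f n" by (simp add: f_def)
  then have "Rep_padic2 (Abs_padic2 f) = f" by (intro Abs_padic2_inverse) simp
  then have "a * Abs_padic2 f = 1"
    using f by (intro padic2_eqI) (simp add: times_padic2.rep_eq one_padic2.rep_eq)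
  then show thesis by (rule that)
qed

lemma Idl_singleton: "Idl\<^bsub>type_ring\<^esub> {a} = {b. a dvd (b :: 'a::comm_ring_1)}"
  unfolding Idl_insert Idl_empty by (auto simp: ideal_plus_def dvd_def mult.commute)

lemma ideal_padic2:
  assumes I: "ideal (I :: padic2 set) type_ring"
  obtains "I = {0}" | n where "I = {a. 2 ^ n dvd a}"
proof (cases "I \<subseteq> {0}")
  case True
  then show thesis using ideal_zeroD[OF I] that(1) by blast
next
  case False
  then obtain a where a: "a \<in> I" "a \<noteq> 0" by blast
  then obtain k where "Rep_padic2 a k \<noteq> 0"
    using padic2_eqI[of a 0] by (auto simp: zero_padic2.rep_eq)
  then have ex: "\<not> I \<subseteq> {a. 2 ^ k dvd a}" using a by (auto simp: two_power_dvd_padic2_iff)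
  \<comment> \<open>\<open>m\<close> is positive, since \<open>2 ^ 0\<close> divides everything. Its
    predecessor \<open>n\<close> is the least valuation in \<open>I\<close>, attained by some
    \<open>c\<close> that is \<open>2 ^ n\<close> times a unit.\<close>
  define m where "m = (LEAST k. \<not> I \<subseteq> {a. 2 ^ k dvd a})"
  have m: "\<not> I \<subseteq> {a. 2 ^ m dvd a}" unfolding m_def using ex by (rule LeastI)
  then obtain n where n: "m = Suc n" by (cases m) auto
  have sub: "I \<subseteq> {a. 2 ^ n dvd a}" using not_less_Least[of n "\<lambda>k. \<not> I \<subseteq> {a. 2 ^ k dvd a}"] n m_def by simp
  obtain c where c: "c \<in> I" "\<not> 2 ^ m dvd c" using m by blast
  then obtain d where d: "c = 2 ^ n * d" using sub by (auto elim: dvdE)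
  have "\<not> 2 dvd d"
  proof
    assume "2 dvd d"
    then have "2 ^ n * 2 dvd c" unfolding d by (rule mult_dvd_mono[OF dvd_refl])
    then show False using c(2) n by (simp add: mult.commute)
  qed
  then obtain e where "d * e = 1"
    using padic2_odd_unit[of d] two_power_dvd_padic2_iff[of 1 d] by auto
  then have "2 ^ n = c * e" by (simp add: d mult.assoc)
  then have "2 ^ n \<in> I" using ideal_mult_rightD[OF I c(1)] by simp
  then have "{a. 2 ^ n dvd a} \<subseteq> I" using ideal_mult_rightD[OF I] by (auto elim!: dvdE)
  then show thesis using sub that(2) by blast
qed

lemma ideal_power_padic2: "ideal_power {a :: padic2. 2 dvd a} n = {a. 2 ^ n dvd a}"
proof (induction n)
  case (Suc n)
  have "ideal {a :: padic2. 2 ^ Suc n dvd a} type_ring"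
    by (auto simp: ideal_type_ring_iff simp del: power_Suc)
  then have "ideal_prod type_ring {a. 2 ^ n dvd a} {a :: padic2. 2 dvd a} \<subseteq> {a. 2 ^ Suc n dvd a}"
    by (rule ideal_prod_subsetI) (auto simp: mult.commute[of 2] intro: mult_dvd_mono)
  moreover have "a \<in> ideal_prod type_ring {a. 2 ^ n dvd a} {a :: padic2. 2 dvd a}" if "2 ^ Suc n dvd a" for a
  proof -
    obtain b where "a = 2 ^ Suc n * b" using \<open>2 ^ Suc n dvd a\<close> by (rule dvdE)
    then have "a = (2 ^ n * b) * 2" by simp
    then show ?thesis by (auto intro!: ideal_prod_mult)
  qed
  ultimately show ?case unfolding ideal_power_Suc Suc by blast
qed simp

lemma adically_complete_padic2: "adically_complete type_ring {a :: padic2. 2 dvd a}"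
  unfolding adically_complete_def ideal_power_padic2
proof (intro conjI allI impI)
  show "(\<Inter>n. {a :: padic2. 2 ^ n dvd a}) = {\<zero>\<^bsub>type_ring\<^esub>}"
    using padic2_eqI[of _ 0] by (auto simp: two_power_dvd_padic2_iff zero_padic2.rep_eq)
  fix s :: "nat \<Rightarrow> padic2"
  assume "\<forall>n. s n \<in> carrier type_ring \<and> s (Suc n) \<ominus>\<^bsub>type_ring\<^esub> s n \<in> {a. 2 ^ n dvd a}"
  then have "Rep_padic2 (s (Suc n) - s n) n = 0" for n by (simp add: two_power_dvd_padic2_iff)
  then have s: "Rep_padic2 (s (Suc n)) n mod 2 ^ n = Rep_padic2 (s n) n mod 2 ^ n" for n
    by (simp add: minus_padic2.rep_eq mod_eq_dvd_iff dvd_eq_mod_eq_0)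
  \<comment> \<open>From index \<open>n\<close> on, the terms agree modulo \<open>2 ^ n\<close>, so
    the diagonal residues define the limit.\<close>
  define f where "f n = Rep_padic2 (s n) n" for n
  have "\<forall>n. f n \<in> {0..<2 ^ n} \<and> f (Suc n) mod 2 ^ n = f n"
    using s Rep_padic2_range Rep_padic2_mod[of "s (Suc n)" n 1 for n] by (simp add: f_def)
  then have "Rep_padic2 (Abs_padic2 f) = f" by (intro Abs_padic2_inverse) simp
  then have "Abs_padic2 f - s n \<in> {a. 2 ^ n dvd a}" for n
    by (simp add: two_power_dvd_padic2_iff minus_padic2.rep_eq f_def)
  then show "\<exists>l\<in>carrier type_ring. \<forall>n. l \<ominus>\<^bsub>type_ring\<^esub> s n \<in> {a. 2 ^ n dvd a}"
    by (intro bexI[of _ "Abs_padic2 f"]) auto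
qed

lemma two_not_dvd_one_padic2: "\<not> (2 :: padic2) dvd 1"
  using two_power_dvd_padic2_iff[of 1 1] by (simp add: one_padic2.rep_eq)

lemma padic2_unit: "\<not> 2 dvd a \<Longrightarrow> \<exists>b. a * b = (1 :: padic2)"
  using two_power_dvd_padic2_iff[of 1 a] padic2_odd_unit[of a] by auto

lemma ideal_even_padic2: "ideal {a :: padic2. 2 dvd a} type_ring"
  using ideal_Idl[of "{2}"] by (simp add: Idl_singleton)

lemma prime_even_padic2: "primeideal {a :: padic2. 2 dvd a} type_ring"
  by (rule nonunits_local(4)[OF ideal_even_padic2]) (simp_all add: two_not_dvd_one_padic2 padic2_unit)

lemma complete_regular_data_padic2: "complete_regular_data 1 {a :: padic2. 2 dvd a}"
proof -
  have "noetherian_ring (type_ring :: padic2 ring)"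
  proof (rule ring.noetherian_ringI[OF type_ring_ring])
    fix I :: "padic2 set" assume "ideal I type_ring"
    then have "\<exists>a. I = Idl\<^bsub>type_ring\<^esub> {a}"
    proof (cases rule: ideal_padic2)
      case 1
      then show ?thesis by (intro exI[of _ 0]) (simp add: Idl_singleton)
    next
      case (2 n)
      then show ?thesis by (intro exI[of _ "2 ^ n"]) (simp add: Idl_singleton)
    qed
    then obtain a where "I = Idl\<^bsub>type_ring\<^esub> {a}" by (rule exE)
    then show "\<exists>A\<subseteq>carrier type_ring. finite A \<and> I = Idl\<^bsub>type_ring\<^esub> A"
      by (intro exI[of _ "{a}"]) simp
  qed
  moreover have "\<exists>p. prime_chain 1 (p :: nat \<Rightarrow> padic2 set)"
  proof
    have zero_prime: "primeideal {0 :: padic2} type_ring"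
      by (simp add: primeideal_type_ring_iff ideal_type_ring_iff)
    have "(2 :: padic2) \<noteq> 0" using of_nat_padic2_neq_0[of 2] by simp
    then have "2 \<notin> {0 :: padic2}" "2 \<in> {a :: padic2. 2 dvd a}" "{0} \<subseteq> {a :: padic2. 2 dvd a}" by auto
    then have "{0} \<subset> {a :: padic2. 2 dvd a}" by blast
    then show "prime_chain 1 (\<lambda>i. if i = 0 then {0} else {a :: padic2. 2 dvd a})"
      using prime_even_padic2 zero_prime by (simp add: prime_chain_def)
  qed
  moreover have "\<exists>A. finite A \<and> card A = 1 \<and> {a :: padic2. 2 dvd a} = Idl\<^bsub>type_ring\<^esub> A"
    by (intro exI[of _ "{2}"]) (simp add: Idl_singleton)
  moreover have "\<forall>a. a \<notin> {a :: padic2. 2 dvd a} \<longrightarrow> (\<exists>b. a * b = 1)"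
    using padic2_unit by blast
  moreover have "1 \<notin> {a :: padic2. 2 dvd a}" using two_not_dvd_one_padic2 by simp
  ultimately show ?thesis
    unfolding complete_regular_data_def
    by (intro conjI ideal_even_padic2 adically_complete_padic2)
qed

lemma add_pow_type_ring: "[n] \<cdot>\<^bsub>type_ring\<^esub> a = of_nat n * (a :: 'a::comm_ring_1)"
proof -
  interpret ring "type_ring :: 'a ring" by (rule type_ring_ring)
  show ?thesis by (induction n) (simp_all add: distrib_right add.commute)
qed

lemma char_zero_type_ring: "char_zero (type_ring :: padic2 fps fps ring)"
proof -
  have "(of_nat n :: padic2 fps fps) \<noteq> 0" if "0 < n" for n
  proof
    assume "(of_nat n :: padic2 fps fps) = 0"
    then have "fps_nth (fps_nth (of_nat n :: padic2 fps fps) 0) 0 = 0" by simp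
    then show False using of_nat_padic2_neq_0[OF that] by (simp add: fps_of_nat[symmetric])
  qed
  then show ?thesis by (simp add: char_zero_def add_pow_type_ring)
qed

lemma complete_regular_R: "complete_regular_data 3 (fps_ideal (fps_ideal {a :: padic2. 2 dvd a}))"
  using complete_regular_data_fps[OF complete_regular_data_fps[OF complete_regular_data_padic2]]
  by (simp add: numeral_3_eq_3)

section \<open>The extension from \<open>R\<close> to \<open>S\<close> and the ideals \<open>P\<close> and \<open>N\<close>\<close>

lemma ring_R_eq: "ring_R = type_ring" and ring_S_eq: "ring_S = type_ring"
  by (simp_all add: ring_R_def ring_S_def)

lemma phi_add: "phi (f + g) = phi f + phi g"
  and phi_mult: "phi (f * g) = phi f * phi g"
  and phi_one: "phi 1 = 1"
  using phi_hom by (simp_all add: ring_R_eq ring_S_eq ring_hom_def)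

lemma phi_zero: "phi 0 = 0"
  using phi_add[of 0 0] by (metis add_cancel_right_right add_0)

lemma phi_diff: "phi (f - g) = phi f - phi g"
  using phi_add[of "f - g" g] by (simp add: algebra_simps)

lemma phi_power: "phi (f ^ n) = phi f ^ n"
  by (induction n) (simp_all add: phi_one phi_mult)

lemma phi_two: "phi 2 = 2"
  using phi_add[of 1 1] by (simp add: phi_one)

text \<open>\<open>phi a\<close> carries only even and \<open>phi b * t_S\<close> only odd powers of
  \<open>t\<close>, so the two parts of \<open>m\<close> determine \<open>a\<close> and
  \<open>b\<close>. The equivalence yields existence and uniqueness of coordinates for the basis
  \<open>1\<close>, \<open>t\<close> at once.\<close>

lemma phi_free_iff:
  "m = phi a + phi b * t_S \<longleftrightarrow>
     (\<forall>j k. fps_nth (fps_nth a j) k = fps_nth (fps_nth m j) (2 * k) \<and>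
            fps_nth (fps_nth b j) k = fps_nth (fps_nth m j) (Suc (2 * k)))"
  (is "_ \<longleftrightarrow> ?R")
proof -
  let ?s = "phi a + phi b * t_S"
  have s: "fps_nth (fps_nth ?s j) (2 * k) = fps_nth (fps_nth a j) k"
    "fps_nth (fps_nth ?s j) (Suc (2 * k)) = fps_nth (fps_nth b j) k" for j k
    by (cases k; simp add: t_S_def phi_nth_nth fps_X_mult_right_nth)+
  show ?thesis
  proof
    show "m = ?s \<Longrightarrow> ?R" by (simp only: s simp_thms)
    assume R: ?R
    have "fps_nth (fps_nth m j) n = fps_nth (fps_nth ?s j) n" for j n
    proof (cases "even n")
      case True
      then obtain k where "n = 2 * k" by (rule evenE)
      then show ?thesis using R s by simp
    next
      case False
      then obtain k where "n = Suc (2 * k)" by (auto elim: oddE)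
      then show ?thesis using R s by simp
    qed
    then show "m = ?s" by (simp add: fps_eq_iff)
  qed
qed

lemma free_of_rank_S: "free_of_rank ring_R (restrict_scalars phi ring_S) 2"
proof -
  let ?M = "restrict_scalars phi ring_S"
  have M: "carrier ?M = UNIV" "\<And>a b. a \<oplus>\<^bsub>?M\<^esub> b = a + b" "\<And>r s. r \<odot>\<^bsub>?M\<^esub> s = phi r * s"
    "\<zero>\<^bsub>?M\<^esub> = 0"
    by (simp_all add: restrict_scalars_def ring_S_eq)
  have "abelian_group ?M"
  proof (rule abelian_groupI)
    show "\<exists>y\<in>carrier ?M. y \<oplus>\<^bsub>?M\<^esub> x = \<zero>\<^bsub>?M\<^esub>" for x
      by (intro bexI[of _ "- x"]) (simp_all add: M)
  qed (simp_all add: M algebra_simps)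
  then have "module ring_R ?M"
    unfolding ring_R_eq
    by (intro moduleI type_ring_cring) (simp_all add: M phi_add phi_mult phi_one algebra_simps)
  then interpret module ring_R ?M .
  define b where "b i = (if i = 0 then 1 else t_S)" for i :: nat
  have sum: "(\<Oplus>\<^bsub>?M\<^esub>i\<in>{..<2}. c i \<odot>\<^bsub>?M\<^esub> b i) = phi (c 0) + phi (c 1) * t_S" for c
  proof -
    have "{..<2} = {..Suc 0}" by auto
    then show ?thesis
      using M.finsum_Suc[of "\<lambda>i. c i \<odot>\<^bsub>?M\<^esub> b i" 0] M.finsum_0[of "\<lambda>i. c i \<odot>\<^bsub>?M\<^esub> b i"]
      by (simp add: M b_def add.commute)
  qed
  have "\<exists>!c. c \<in> {..<2} \<rightarrow>\<^sub>E carrier ring_R \<and> m = (\<Oplus>\<^bsub>?M\<^esub>i\<in>{..<2}. c i \<odot>\<^bsub>?M\<^esub> b i)" for m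
  proof (rule ex1I)
    \<comment> \<open>Coordinates are extensional functions: the restriction makes \<open>c\<close>
      undefined from 2 on, where any competitor must agree with it.\<close>
    define c where "c = (\<lambda>i\<in>{..<2::nat}. Abs_fps (\<lambda>j. Abs_fps (\<lambda>k. fps_nth (fps_nth m j) (2 * k + i))))"
    show "c \<in> {..<2} \<rightarrow>\<^sub>E carrier ring_R \<and> m = (\<Oplus>\<^bsub>?M\<^esub>i\<in>{..<2}. c i \<odot>\<^bsub>?M\<^esub> b i)"
      unfolding sum phi_free_iff by (simp add: c_def ring_R_eq)
    fix c' assume c': "c' \<in> {..<2} \<rightarrow>\<^sub>E carrier ring_R \<and> m = (\<Oplus>\<^bsub>?M\<^esub>i\<in>{..<2}. c' i \<odot>\<^bsub>?M\<^esub> b i)"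
    have "m = phi (c' 0) + phi (c' 1) * t_S" using conjunct2[OF c'] unfolding sum .
    note m = this[unfolded phi_free_iff, rule_format]
    show "c' = c"
    proof
      fix i :: nat
      consider "i = 0" | "i = 1" | "i \<ge> 2" by linarith
      then show "c' i = c i"
      proof cases
        assume "i \<ge> 2"
        then show ?thesis using PiE_arb[OF conjunct1[OF c'], of i] by (simp add: c_def)
      qed (simp_all add: fps_eq_iff c_def m[THEN conjunct1] m[THEN conjunct2, unfolded One_nat_def])
    qed
  qed
  then show ?thesis
    unfolding free_of_rank_def
    by (intro conjI bexI[of _ b] ballI \<open>module ring_R ?M\<close>) (simp_all add: M)
qed

section \<open>Division by a binomial and Gauss's lemma for power series\<close>

lemma Idl_pair: "Idl\<^bsub>type_ring\<^esub> {a, b} = {u * a + v * b | u v. True :: bool}" for a b :: "'a::comm_ring_1"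
proof -
  have "Idl\<^bsub>type_ring\<^esub> {a, b} = Idl\<^bsub>type_ring\<^esub> {b, a}" by (simp add: insert_commute)
  also have "\<dots> = {u * a + v * b | u v. True}"
    unfolding Idl_insert[of b "{a}"] Idl_singleton ideal_plus_def dvd_def by (auto simp: mult.commute)
  finally show ?thesis .
qed

text \<open>
  \<open>geom_sum d c\<close> is the \<open>X\<close>-adically convergent series \<open>\<Sum>i. X\<^bsup>d i\<^esup> c i\<close> (for \<open>d > 0\<close>); it sums
  the quotient of the division by \<open>Y\<^sup>m - X\<^sup>d\<close> in closed form.
\<close>

definition geom_sum :: "nat \<Rightarrow> (nat \<Rightarrow> 'a::comm_ring_1 fps) \<Rightarrow> 'a fps" where
  "geom_sum d c = Abs_fps (\<lambda>n. \<Sum>i\<le>n div d. fps_nth (c i) (n - d * i))"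

lemma geom_sum_rec:
  assumes "0 < d"
  shows "geom_sum d c = c 0 + fps_X ^ d * geom_sum d (\<lambda>i. c (Suc i))"
proof (rule fps_ext)
  fix n
  show "fps_nth (geom_sum d c) n = fps_nth (c 0 + fps_X ^ d * geom_sum d (\<lambda>i. c (Suc i))) n"
  proof (cases "n < d")
    case True
    then show ?thesis by (simp add: geom_sum_def fps_X_power_mult_nth)
  next
    case False
    then have "n div d = Suc ((n - d) div d)" using assms by (simp add: le_div_geq)
    then show ?thesis
      using False by (simp add: geom_sum_def fps_X_power_mult_nth sum.atMost_Suc_shift del: sum.atMost_Suc)
  qed
qed

text \<open>A remainder of degree below \<open>m\<close> in the outer variable means
  \<open>q_j = f_(j+m) + X^d q_(j+m)\<close> for all \<open>j\<close>. Unfolding this recursion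
  gives the series used for \<open>q\<close>, which converges since \<open>d\<close> is
  positive.\<close>

lemma weierstrass_division_binomial:
  fixes f :: "'a::comm_ring_1 fps fps"
  assumes "0 < d"
  obtains q where
    "\<And>n. n \<ge> m \<Longrightarrow> fps_nth (f - (fps_X ^ m - fps_const (fps_X ^ d)) * q) n = 0"
proof -
  define q where "q = Abs_fps (\<lambda>j. geom_sum d (\<lambda>i. fps_nth f (j + m + m * i)))"
  have q: "fps_nth q j = fps_nth f (j + m) + fps_X ^ d * fps_nth q (j + m)" for j
    unfolding q_def fps_nth_Abs_fps by (subst geom_sum_rec[OF assms]) (simp add: ac_simps)
  have "fps_nth (f - (fps_X ^ m - fps_const (fps_X ^ d)) * q) n = 0" if "n \<ge> m" for n
    using that q[of "n - m"] by (simp add: left_diff_distrib fps_X_power_mult_nth)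
  then show thesis by (rule that)
qed

text \<open>If neither factor has all its coefficients in \<open>I\<close>, take in each the first
  coefficient outside \<open>I\<close>: their product is, modulo \<open>I\<close>, a coefficient of
  the product series. Applied to (2), this says that F_2[[t]] is a domain.\<close>

lemma fps_coeff_primeideal:
  fixes I :: "'a::comm_ring_1 set"
  assumes I: "primeideal I type_ring"
  shows "primeideal {f. \<forall>i. fps_nth f i \<in> I} type_ring"
  unfolding primeideal_type_ring_iff
proof (intro conjI allI impI)
  note Ii = prime_idealD[OF I]
  show "ideal {f. \<forall>i. fps_nth f i \<in> I} type_ring"
    unfolding ideal_type_ring_iff
  proof (safe)
    fix f g r :: "'a fps" and i
    assume f: "\<forall>i. fps_nth f i \<in> I"
    show "fps_nth (r * f) i \<in> I"
      unfolding fps_mult_nth by (intro ideal_sumD[OF Ii] ideal_multD[OF Ii] f[rule_format])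
    assume "\<forall>i. fps_nth g i \<in> I"
    then show "fps_nth (f + g) i \<in> I" using f ideal_addD[OF Ii] by simp
  qed (simp add: ideal_zeroD[OF Ii])
  have "fps_nth (1 :: 'a fps) 0 \<notin> I" using prime_oneD[OF I] by simp
  then show "1 \<notin> {f. \<forall>i. fps_nth f i \<in> I}" by blast
  fix f g assume fg: "f * g \<in> {f. \<forall>i. fps_nth f i \<in> I}"
  show "f \<in> {f. \<forall>i. fps_nth f i \<in> I} \<or> g \<in> {f. \<forall>i. fps_nth f i \<in> I}"
  proof (rule ccontr)
    assume *: "\<not> ?thesis"
    then have ex: "\<exists>i. fps_nth f i \<notin> I" "\<exists>i. fps_nth g i \<notin> I" by auto
    define i where "i = (LEAST i. fps_nth f i \<notin> I)"
    define j where "j = (LEAST i. fps_nth g i \<notin> I)"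
    have i: "fps_nth f i \<notin> I" unfolding i_def by (rule LeastI_ex[OF ex(1)])
    have i_less: "fps_nth f k \<in> I" if "k < i" for k
      using not_less_Least[of k "\<lambda>i. fps_nth f i \<notin> I"] that unfolding i_def by blast
    have j: "fps_nth g j \<notin> I" unfolding j_def by (rule LeastI_ex[OF ex(2)])
    have j_less: "fps_nth g k \<in> I" if "k < j" for k
      using not_less_Least[of k "\<lambda>i. fps_nth g i \<notin> I"] that unfolding j_def by blast
    let ?S = "\<Sum>k\<in>{0..i + j} - {i}. fps_nth f k * fps_nth g (i + j - k)"
    have eq: "fps_nth (f * g) (i + j)
        = fps_nth f i * fps_nth g j + ?S"
      unfolding fps_mult_nth by (subst sum.remove[of _ i]) auto
    have S: "?S \<in> I"
    proof (rule ideal_sumD[OF Ii])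
      fix k assume k: "k \<in> {0..i + j} - {i}"
      show "fps_nth f k * fps_nth g (i + j - k) \<in> I"
      proof (cases "k < i")
        case True
        then show ?thesis by (intro ideal_mult_rightD[OF Ii] i_less)
      next
        case False
        then have "i + j - k < j" using k by auto
        then show ?thesis by (intro ideal_multD[OF Ii] j_less)
      qed
    qed
    have "fps_nth (f * g) (i + j) \<in> I" using fg by simp
    from ideal_diffD[OF Ii this S] have "fps_nth f i * fps_nth g j \<in> I" unfolding eq by simp
    then show False using prime_multD[OF I] i j by blast
  qed
qed

lemma fps_const_dvdI:
  assumes "\<And>i. c dvd fps_nth f i"
  shows "fps_const (c :: 'a::comm_ring_1) dvd f"
proof -
  obtain g where "\<And>i. fps_nth f i = c * g i" using assms unfolding dvd_def by metis
  then have "f = fps_const c * Abs_fps g" by (simp add: fps_eq_iff)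
  then show ?thesis by simp
qed

lemma fps_two: "(2 :: 'a::comm_ring_1 fps) = fps_const 2"
  by (simp add: numeral_fps_const)

text \<open>The kernel of the map from \<open>S\<close> to F_2[[t]] that reduces modulo 2 and sends
  \<open>y\<close> to \<open>t^3\<close>.\<close>

definition ideal_N :: "padic2 fps fps set" where
  "ideal_N = Idl\<^bsub>type_ring\<^esub> {2, y_S - t_S ^ 3}"

lemma ideal_N_ideal: "ideal ideal_N type_ring"
  unfolding ideal_N_def by (rule ideal_Idl)

lemma two_in_N: "2 \<in> ideal_N" and y_t_in_N: "y_S - t_S ^ 3 \<in> ideal_N"
  using in_Idl[of "{2, y_S - t_S ^ 3}"] by (auto simp: ideal_N_def)

lemma t_S_power: "t_S ^ n = fps_const (fps_X ^ n)"
  by (simp add: t_S_def fps_const_power)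

text \<open>This is injectivity of F_2[[t]] into \<open>S/N\<close>. Comparing coefficients of
  powers of \<open>y\<close> gives, modulo 2, that \<open>v_j\<close> is \<open>t^3\<close> times
  \<open>v_(j+1)\<close>; so every \<open>v_j\<close> is divisible by all powers of \<open>t\<close>
  and vanishes modulo 2, and with it \<open>a\<close>.\<close>

lemma fps_const_in_N_iff: "fps_const a \<in> ideal_N \<longleftrightarrow> (\<forall>i. 2 dvd fps_nth a i)"
proof
  assume "\<forall>i. 2 dvd fps_nth a i"
  then have "fps_const 2 dvd a" by (intro fps_const_dvdI) simp
  then obtain b where "a = fps_const 2 * b" by (rule dvdE)
  then have "fps_const a = 2 * fps_const b" by (simp add: fps_two)
  then show "fps_const a \<in> ideal_N" using ideal_mult_rightD[OF ideal_N_ideal two_in_N] by (simp only:)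
next
  assume "fps_const a \<in> ideal_N"
  then obtain u v where "fps_const a = u * 2 + v * (y_S - t_S ^ 3)"
    unfolding ideal_N_def Idl_pair by blast
  then have eq: "fps_const a = 2 * u + fps_X * v - fps_const (fps_X ^ 3) * v"
    by (simp add: y_S_def t_S_power algebra_simps)
  have v: "fps_nth v j = fps_X ^ 3 * fps_nth v (Suc j) - 2 * fps_nth u (Suc j)" for j
    using arg_cong[OF eq, of "\<lambda>f. fps_nth f (Suc j)"] by (simp add: fps_two algebra_simps)
  have a: "a = 2 * fps_nth u 0 - fps_X ^ 3 * fps_nth v 0"
    using arg_cong[OF eq, of "\<lambda>f. fps_nth f 0"] by (simp add: fps_two)
  have even_v: "2 dvd fps_nth (fps_nth v j) i" for i j
  proof (induction i arbitrary: j rule: less_induct)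
    case (less i)
    show ?case
      by (subst v) (use less in \<open>auto simp: fps_X_power_mult_nth fps_two intro!: dvd_diff\<close>)
  qed
  show "\<forall>i. 2 dvd fps_nth a i"
    unfolding a using even_v by (auto simp: fps_X_power_mult_nth fps_two intro!: dvd_diff)
qed

text \<open>This is surjectivity of F_2[[t]] onto \<open>S/N\<close>: after division by
  \<open>y - t^3\<close>, of degree 1 in \<open>y\<close>, the remainder is a series in
  \<open>t\<close> alone.\<close>

lemma mod_N_const: obtains r where "f - fps_const r \<in> ideal_N"
proof -
  obtain q where q: "\<And>n. n \<ge> 1 \<Longrightarrow> fps_nth (f - (fps_X ^ 1 - fps_const (fps_X ^ 3)) * q) n = 0"
    using weierstrass_division_binomial[of 3 1 f] by auto
  let ?r = "fps_nth (f - (y_S - t_S ^ 3) * q) 0"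
  have "f - (y_S - t_S ^ 3) * q = fps_const ?r"
    using q by (auto simp: fps_eq_iff[where 'a = "padic2 fps"] y_S_def t_S_power)
  then have "f - fps_const ?r = (y_S - t_S ^ 3) * q" by (simp add: algebra_simps)
  then show thesis using that ideal_mult_rightD[OF ideal_N_ideal y_t_in_N] by metis
qed

lemma prime_N: "primeideal ideal_N type_ring"
  unfolding primeideal_type_ring_iff
proof (intro conjI allI impI)
  note Ni = ideal_N_ideal
  show "ideal ideal_N type_ring" by (rule Ni)
  have "\<not> (\<forall>i. 2 dvd fps_nth (1 :: padic2 fps) i)"
    using two_not_dvd_one_padic2 by (auto intro!: exI[of _ 0])
  then show "1 \<notin> ideal_N" using fps_const_in_N_iff[of 1] by simp
  fix f g assume fg: "f * g \<in> ideal_N"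
  obtain r where r: "f - fps_const r \<in> ideal_N" by (rule mod_N_const)
  obtain s where s: "g - fps_const s \<in> ideal_N" by (rule mod_N_const)
  have "f * g - (g * (f - fps_const r) + fps_const r * (g - fps_const s)) \<in> ideal_N"
    by (intro ideal_diffD[OF Ni fg] ideal_addD[OF Ni] ideal_multD[OF Ni] r s)
  then have "fps_const (r * s) \<in> ideal_N" by (simp add: algebra_simps)
  then have "r * s \<in> {f. \<forall>i. fps_nth f i \<in> {a. 2 dvd a}}" by (simp only: fps_const_in_N_iff mem_Collect_eq) simp
  then have "fps_const r \<in> ideal_N \<or> fps_const s \<in> ideal_N"
    using prime_multD[OF fps_coeff_primeideal[OF prime_even_padic2], of r s] by (simp add: fps_const_in_N_iff)
  then show "f \<in> ideal_N \<or> g \<in> ideal_N"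
    using ideal_addD[OF Ni r, of "fps_const r"] ideal_addD[OF Ni s, of "fps_const s"] by auto
qed

section \<open>P as a preimage, and the radical of PS\<close>

lemma ideal_P_ideal: "ideal ideal_P type_ring"
  unfolding ideal_P_def ring_R_eq by (rule ideal_Idl)

lemma two_in_P: "2 \<in> ideal_P" and cusp_in_P: "y_R ^ 2 - x_R ^ 3 \<in> ideal_P"
  using in_Idl[of "{2, y_R ^ 2 - x_R ^ 3}"] by (auto simp: ideal_P_def ring_R_eq)

lemma phi_cusp: "phi (y_R ^ 2 - x_R ^ 3) = (y_S - t_S ^ 3) * (y_S + t_S ^ 3)"
  unfolding phi_diff phi_power phi_x phi_y
  by (simp add: algebra_simps power2_eq_square power3_eq_cube)

lemma ideal_P_eq: "ideal_P = {f. phi f \<in> ideal_N}"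
proof
  note Ni = ideal_N_ideal
  have "ideal {f. phi f \<in> ideal_N} type_ring"
    unfolding ideal_type_ring_iff using ideal_zeroD[OF Ni] ideal_addD[OF Ni] ideal_multD[OF Ni]
    by (simp add: phi_zero phi_add phi_mult)
  then show "ideal_P \<subseteq> {f. phi f \<in> ideal_N}"
    unfolding ideal_P_def ring_R_eq
    by (rule Idl_subset)
      (use two_in_N ideal_mult_rightD[OF Ni y_t_in_N] in \<open>simp add: phi_two phi_cusp\<close>)
  show "{f. phi f \<in> ideal_N} \<subseteq> ideal_P"
  proof safe
    fix f assume f: "phi f \<in> ideal_N"
    obtain q where q: "\<And>n. n \<ge> 2 \<Longrightarrow> fps_nth (f - (fps_X ^ 2 - fps_const (fps_X ^ 3)) * q) n = 0"
      using weierstrass_division_binomial[of 3 2 f] by auto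
    define e where "e = f - (y_R ^ 2 - x_R ^ 3) * q"
    define g h where "g = fps_nth e 0" and "h = fps_nth e 1"
    have e_high: "fps_nth e n = 0" if "n \<ge> 2" for n
      using q[OF that] by (simp add: e_def y_R_def x_R_def fps_const_power)
    have "fps_nth e n = fps_nth (fps_const g + y_R * fps_const h) n" for n
    proof -
      consider "n = 0" | "n = 1" | "n \<ge> 2" by linarith
      then show ?thesis by cases (auto simp: g_def h_def y_R_def e_high)
    qed
    then have e: "e = fps_const g + y_R * fps_const h" by (rule fps_ext)
    have phi_fps_const: "phi (fps_const c) = fps_const (c oo fps_X ^ 2)" for c
      by (rule fps_ext) (simp add: phi_def)
    have "phi e = phi f - phi (y_R ^ 2 - x_R ^ 3) * phi q" by (simp add: e_def phi_diff phi_mult)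
    also have "\<dots> \<in> ideal_N"
      unfolding phi_cusp using f ideal_mult_rightD[OF Ni ideal_mult_rightD[OF Ni y_t_in_N]]
      by (intro ideal_diffD[OF Ni]) auto
    \<comment> \<open>Subtracting this multiple of \<open>y - t^3\<close> replaces \<open>y\<close>
      by \<open>t^3\<close> in \<open>phi e\<close>, leaving the series
      \<open>g(t^2) + t^3 h(t^2)\<close> free of \<open>y\<close>.\<close>
    finally have "phi e - (y_S - t_S ^ 3) * fps_const (h oo fps_X ^ 2) \<in> ideal_N"
      by (intro ideal_diffD[OF Ni] ideal_mult_rightD[OF Ni y_t_in_N])
    also have "phi e - (y_S - t_S ^ 3) * fps_const (h oo fps_X ^ 2)
        = fps_const ((g oo fps_X ^ 2) + fps_X ^ 3 * (h oo fps_X ^ 2))"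
      by (simp add: e phi_add phi_mult phi_y phi_fps_const t_S_power algebra_simps)
    finally have even: "2 dvd fps_nth ((g oo fps_X ^ 2) + fps_X ^ 3 * (h oo fps_X ^ 2)) i" for i
      by (simp only: fps_const_in_N_iff)
    \<comment> \<open>The two summands cannot interfere: coefficient \<open>2 * i\<close> is that of
      \<open>g\<close> at \<open>i\<close>, and coefficient \<open>2 * i + 3\<close>, an odd index,
      is that of \<open>h\<close> at \<open>i\<close>.\<close>
    have "2 dvd fps_nth g i" for i
      using even[of "2 * i"] by (simp add: fps_X_power_mult_nth fps_nth_compose_X_power split: if_splits)
    moreover have "2 dvd fps_nth h i" for i
      using even[of "2 * i + 3"] by (simp add: fps_X_power_mult_nth fps_nth_compose_X_power split: if_splits)
    ultimately have "fps_const 2 dvd g" "fps_const 2 dvd h" by (auto intro: fps_const_dvdI)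
    then obtain g' h' where "g = fps_const 2 * g'" "h = fps_const 2 * h'" by (auto elim!: dvdE)
    then have "e = 2 * (fps_const g' + y_R * fps_const h')"
      by (simp add: e fps_two algebra_simps)
    then have "f = 2 * (fps_const g' + y_R * fps_const h') + (y_R ^ 2 - x_R ^ 3) * q"
      by (simp add: e_def algebra_simps)
    then show "f \<in> ideal_P"
      using ideal_addD[OF ideal_P_ideal ideal_mult_rightD[OF ideal_P_ideal two_in_P]
          ideal_mult_rightD[OF ideal_P_ideal cusp_in_P]] by (simp only:)
  qed
qed

lemma prime_P: "primeideal ideal_P type_ring"
  using ideal_P_ideal prime_N unfolding primeideal_type_ring_iff ideal_P_eq by (simp add: phi_one phi_mult)

lemma ideal_radical_PS: "ideal_radical ring_S ideal_PS = ideal_N"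
proof
  have PS: "ideal_PS = Idl\<^bsub>type_ring\<^esub> (phi ` ideal_P)" by (simp add: ideal_PS_def ring_S_eq)
  have "ideal_PS \<subseteq> ideal_N"
    unfolding PS by (rule Idl_subset[OF ideal_N_ideal]) (auto simp: ideal_P_eq)
  then show "ideal_radical ring_S ideal_PS \<subseteq> ideal_N"
    using prime_powerD[OF prime_N] by (auto simp: ideal_radical_def ring_S_eq)
  show "ideal_N \<subseteq> ideal_radical ring_S ideal_PS"
  proof
    have PSi: "ideal ideal_PS type_ring" unfolding PS by (rule ideal_Idl)
    have two: "2 \<in> ideal_PS"
      using in_Idl[of "phi ` ideal_P"] two_in_P phi_two unfolding PS by force
    have cusp: "(y_S - t_S ^ 3) * (y_S + t_S ^ 3) \<in> ideal_PS"
      using in_Idl[of "phi ` ideal_P"] cusp_in_P phi_cusp unfolding PS by force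
    fix f assume "f \<in> ideal_N"
    then obtain u v where f: "f = u * 2 + v * (y_S - t_S ^ 3)"
      unfolding ideal_N_def Idl_pair by blast
    \<comment> \<open>Squares already suffice:
      \<open>(y - s)^2 = (y - s) (y + s) - 2 s (y - s)\<close> combines the image of the cusp
      equation with a multiple of 2.\<close>
    have "(u * 2 + v * (y - s))\<^sup>2 = 2 * (2 * u\<^sup>2 + 2 * u * v * (y - s) - v\<^sup>2 * s * (y - s))
        + (y - s) * (y + s) * v\<^sup>2" for y s
      by (simp add: power2_eq_square algebra_simps)
    then have "f ^ 2 = 2 * (2 * u\<^sup>2 + 2 * u * v * (y_S - t_S ^ 3) - v\<^sup>2 * t_S ^ 3 * (y_S - t_S ^ 3))
        + (y_S - t_S ^ 3) * (y_S + t_S ^ 3) * v\<^sup>2"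
      unfolding f .
    also have "\<dots> \<in> ideal_PS"
      by (intro ideal_addD[OF PSi] ideal_mult_rightD[OF PSi] two cusp)
    finally show "f \<in> ideal_radical ring_S ideal_PS"
      by (auto simp: ideal_radical_def ring_S_eq intro!: exI[of _ 2])
  qed
qed

section \<open>The quotient rings\<close>

definition max_ideal_R :: "padic2 fps fps set" where
  "max_ideal_R = fps_ideal (fps_ideal {a. 2 dvd a})"

lemma max_ideal_R_local:
  shows "noetherian_ring (type_ring :: padic2 fps fps ring)"
    and "ideal max_ideal_R type_ring" "1 \<notin> max_ideal_R"
    and "\<forall>a. a \<notin> max_ideal_R \<longrightarrow> (\<exists>b. a * b = 1)"
  using complete_regular_R unfolding complete_regular_data_def max_ideal_R_def by blast+

lemmas max_ideal_R_props = nonunits_local[OF max_ideal_R_local(2-4)]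

lemma max_ideal_R_eq: "max_ideal_R = Idl\<^bsub>type_ring\<^esub> {y_R, x_R, 2}"
proof -
  have "{a :: padic2. 2 dvd a} = Idl\<^bsub>type_ring\<^esub> {2}" by (simp add: Idl_singleton)
  then show ?thesis
    by (simp add: max_ideal_R_def fps_ideal_Idl y_R_def x_R_def numeral_fps_const)
qed

lemma max_ideal_R_subset:
  assumes "ideal J type_ring" "2 \<in> J" "x_R \<in> J" "y_R \<in> J"
  shows "max_ideal_R \<subseteq> J"
  unfolding max_ideal_R_eq using assms by (intro Idl_subset) auto

lemma max_ideal_R_gens: "2 \<in> max_ideal_R" "x_R \<in> max_ideal_R" "y_R \<in> max_ideal_R"
  unfolding max_ideal_R_eq using in_Idl[of "{y_R, x_R, 2}"] by auto

text \<open>The preimage of the unique maximal ideal \<open>K\<close> of the quotient is proper,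
  hence inside \<open>M\<close>, so \<open>K\<close> lies in the image of \<open>M\<close>. That
  image is proper because \<open>I\<close> lies in \<open>M\<close>, and maximality of
  \<open>K\<close> gives equality.\<close>

lemma max_ideal_quotient:
  fixes I M :: "'a::comm_ring_1 set"
  assumes N: "noetherian_ring (type_ring :: 'a ring)"
    and M: "ideal M type_ring" "1 \<notin> M" "\<forall>a. a \<notin> M \<longrightarrow> (\<exists>b. a * b = 1)"
    and I: "ideal I type_ring" "I \<subseteq> M"
  shows "noetherian_ring (type_ring Quot I)" "local_ring (type_ring Quot I)"
    "max_ideal (type_ring Quot I) = (+>\<^bsub>type_ring\<^esub>) I ` M"
    "maximalideal ((+>\<^bsub>type_ring\<^esub>) I ` M) (type_ring Quot I)"
proof -
  let ?Q = "type_ring Quot I"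
  let ?h = "(+>\<^bsub>type_ring\<^esub>) I"
  interpret h: ring_hom_ring type_ring ?Q ?h by (rule ideal.rcos_ring_hom_ring[OF I(1)])
  note loc = nonunits_local[OF M]
  have "I \<noteq> carrier type_ring" using I(2) M(2) by auto
  then show "noetherian_ring ?Q" and local: "local_ring ?Q"
    using quotient_noetherian_local[OF N loc(2) I(1)] by auto
  obtain K where K: "maximalideal K ?Q" and uniq: "\<And>K'. maximalideal K' ?Q \<Longrightarrow> K' = K"
    using local unfolding local_ring_def by blast
  note Ki = maximalideal.axioms(1)[OF K]
  have Ksub: "K \<subseteq> carrier ?Q" using Ki by (simp add: additive_subgroup.a_subset ideal.axioms(1))
  have surj: "\<exists>r. z = ?h r" if "z \<in> carrier ?Q" for z
    using that unfolding FactRing_def A_RCOSETS_def'[of type_ring I] by auto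
  have hM: "ideal (?h ` M) ?Q" by (rule h.R.ring_ideal_imp_quot_ideal[OF I(1) M(1)])
  have preK: "ideal {r \<in> carrier type_ring. ?h r \<in> K} type_ring" by (rule h.ideal_vimage[OF Ki])
  have "?h 1 \<notin> K"
  proof
    assume "?h 1 \<in> K"
    then have "\<one>\<^bsub>?Q\<^esub> \<in> K" using h.hom_one by simp
    then show False using ideal.one_imp_carrier[OF Ki] maximalideal.I_notcarr[OF K] by simp
  qed
  then have preK_M: "{r \<in> carrier type_ring. ?h r \<in> K} \<subseteq> M" by (intro loc(5)[OF preK]) simp
  have KM: "K \<subseteq> ?h ` M"
  proof
    fix z assume z: "z \<in> K"
    then obtain r where r: "z = ?h r" using surj Ksub by blast
    then have "r \<in> M" using preK_M z by auto
    then show "z \<in> ?h ` M" using r by blast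
  qed
  have "?h ` M \<noteq> carrier ?Q"
  proof
    assume "?h ` M = carrier ?Q"
    then have "?h 1 \<in> ?h ` M" using h.hom_closed[of 1] by simp
    then obtain m where m: "m \<in> M" "?h 1 = ?h m" by blast
    then have "1 - m \<in> I" using h.R.quotient_eq_iff_same_a_r_cos[OF I(1), of 1 m] by simp
    then have "(1 - m) + m \<in> M" using I(2) m(1) by (intro ideal_addD[OF M(1)]) auto
    then show False using M(2) by simp
  qed
  moreover have "?h ` M \<subseteq> carrier ?Q" using hM by (simp add: additive_subgroup.a_subset ideal.axioms(1))
  ultimately have KhM: "K = ?h ` M" using maximalideal.I_maximal[OF K hM KM] by auto
  then show "maximalideal (?h ` M) ?Q" using K by simp
  show "max_ideal ?Q = ?h ` M"
    unfolding max_ideal_def KhM[symmetric] using K uniq by (rule the_equality)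
qed

text \<open>Principal ideals of cosets become congruences upstairs, where coefficients of power
  series can be compared.\<close>

lemma quotient_in_Idl_singleton:
  fixes I :: "'a::comm_ring_1 set"
  assumes I: "ideal I type_ring"
  shows "I +>\<^bsub>type_ring\<^esub> b \<in> Idl\<^bsub>type_ring Quot I\<^esub> {I +>\<^bsub>type_ring\<^esub> a} \<longleftrightarrow> (\<exists>r. b - r * a \<in> I)"
proof -
  let ?Q = "type_ring Quot I"
  let ?h = "(+>\<^bsub>type_ring\<^esub>) I"
  interpret h: ring_hom_ring type_ring ?Q ?h by (rule ideal.rcos_ring_hom_ring[OF I])
  interpret Q: cring ?Q by (rule ideal.quotient_is_cring[OF I type_ring_cring])
  have surj: "\<exists>r. z = ?h r" if "z \<in> carrier ?Q" for z
    using that unfolding FactRing_def A_RCOSETS_def'[of type_ring I] by auto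
  have "?h b \<in> Idl\<^bsub>?Q\<^esub> {?h a} \<longleftrightarrow> (\<exists>z\<in>carrier ?Q. ?h b = z \<otimes>\<^bsub>?Q\<^esub> ?h a)"
    using Q.cgenideal_eq_genideal[of "?h a"] h.hom_closed[of a] by (auto simp: cgenideal_def)
  also have "\<dots> \<longleftrightarrow> (\<exists>r. ?h b = ?h r \<otimes>\<^bsub>?Q\<^esub> ?h a)"
    using surj h.hom_closed by fastforce
  also have "\<dots> \<longleftrightarrow> (\<exists>r. ?h b = ?h (r * a))"
    using h.hom_mult by simp
  also have "\<dots> \<longleftrightarrow> (\<exists>r. b - r * a \<in> I)"
    using h.R.quotient_eq_iff_same_a_r_cos[OF I, of b] by simp
  finally show ?thesis .
qed

lemma ideal_N_le_max: "ideal_N \<subseteq> max_ideal_R"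
  by (rule max_ideal_R_props(5)[OF ideal_N_ideal prime_oneD[OF prime_N]])

lemma ideal_P_le_max: "ideal_P \<subseteq> max_ideal_R"
  by (rule max_ideal_R_props(5)[OF ideal_P_ideal prime_oneD[OF prime_P]])

lemma t_S_eq: "t_S = x_R" and y_S_eq: "y_S = y_R"
  by (simp_all add: t_S_def x_R_def y_S_def y_R_def)

lemma prime_le_max_ideal_R: "primeideal Q type_ring \<Longrightarrow> Q \<subseteq> max_ideal_R"
  by (rule max_ideal_R_props(5)[OF prime_idealD prime_oneD])

lemma prime_eq_max_ideal_R:
  assumes "primeideal Q type_ring" "2 \<in> Q" "x_R \<in> Q" "y_R \<in> Q"
  shows "Q = max_ideal_R"
  using max_ideal_R_subset[OF prime_idealD[OF assms(1)] assms(2-)] prime_le_max_ideal_R[OF assms(1)] by blast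

lemma y_in_if_t_in:
  assumes "ideal Q type_ring" "ideal_N \<subseteq> Q" "x_R \<in> Q"
  shows "y_R \<in> Q"
proof -
  have "(y_S - t_S ^ 3) + x_R * x_R\<^sup>2 \<in> Q"
    using assms(2) y_t_in_N by (intro ideal_addD[OF assms(1)] ideal_mult_rightD[OF assms(1,3)]) auto
  then show ?thesis by (simp add: t_S_eq y_S_eq power3_eq_cube power2_eq_square)
qed

text \<open>Modulo \<open>P\<close> only \<open>y^2\<close> is a multiple of \<open>x\<close>, so
  here, unlike for \<open>N\<close>, primeness is used: \<open>x\<close> is a parameter of
  \<open>R/P\<close>, which bounds the dimension by 1.\<close>

lemma y_in_if_x_in:
  assumes "primeideal Q type_ring" "ideal_P \<subseteq> Q" "x_R \<in> Q"
  shows "y_R \<in> Q"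
proof (rule prime_powerD[OF assms(1)])
  have "(y_R ^ 2 - x_R ^ 3) + x_R * x_R\<^sup>2 \<in> Q"
    using assms(2) cusp_in_P
    by (intro ideal_addD[OF prime_idealD[OF assms(1)]] ideal_mult_rightD[OF prime_idealD[OF assms(1)] assms(3)]) auto
  then show "y_R ^ 2 \<in> Q" by (simp add: power3_eq_cube power2_eq_square)
qed

lemma regular_quotient_N: "regular_local_ring (type_ring Quot ideal_N)"
proof -
  let ?Q = "type_ring Quot ideal_N"
  let ?h = "(+>\<^bsub>type_ring\<^esub>) ideal_N"
  note Q = max_ideal_quotient[OF max_ideal_R_local ideal_N_ideal ideal_N_le_max]
  interpret h: ring_hom_ring type_ring ?Q ?h by (rule ideal.rcos_ring_hom_ring[OF ideal_N_ideal])
  have t: "{?h x_R} \<subseteq> carrier ?Q" using h.hom_closed[of x_R] by simp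
  have "krull_dim ?Q \<le> enat (card {x_R})"
  proof (rule krull_dim_quotient_le[OF max_ideal_R_local(1) ideal_N_ideal max_ideal_R_props(4)])
    show "Q = max_ideal_R" if "primeideal Q type_ring" "ideal_N \<subseteq> Q" "{x_R} \<subseteq> Q" for Q
      using that two_in_N y_in_if_t_in[OF prime_idealD] by (intro prime_eq_max_ideal_R) auto
  qed (use prime_le_max_ideal_R max_ideal_R_gens in auto)
  \<comment> \<open>Regularity asks for exactly as many generators as the dimension, so the one
    generator \<open>t\<close> must be matched by a chain of length 1.\<close>
  moreover have "enat 1 \<le> krull_dim ?Q"
  proof (rule krull_dim_geI)
    let ?p = "\<lambda>i::nat. if i = 0 then {\<zero>\<^bsub>?Q\<^esub>} else ?h ` max_ideal_R"
    interpret Q: "domain" ?Q by (rule primeideal.quotient_is_domain[OF prime_N])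
    show "\<forall>i\<le>1. primeideal (?p i) ?Q"
      using Q.zeroprimeideal Q.maximalideal_prime[OF Q(4)] by simp
    have "x_R \<notin> ideal_N"
    proof
      assume "x_R \<in> ideal_N"
      then have "\<forall>i. 2 dvd fps_nth (fps_X :: padic2 fps) i" unfolding x_R_def fps_const_in_N_iff .
      then have "2 dvd fps_nth (fps_X :: padic2 fps) 1" by (rule spec)
      then show False using two_not_dvd_one_padic2 by simp
    qed
    then have "?h x_R \<noteq> ?h 0"
      using h.R.quotient_eq_iff_same_a_r_cos[OF ideal_N_ideal, of x_R 0] by simp
    moreover have "?h 0 = \<zero>\<^bsub>?Q\<^esub>" using h.hom_zero by simp
    ultimately have "?h x_R \<notin> {\<zero>\<^bsub>?Q\<^esub>}" by simp
    moreover have "?h x_R \<in> ?h ` max_ideal_R" using max_ideal_R_gens by blast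
    moreover have "\<zero>\<^bsub>?Q\<^esub> \<in> ?h ` max_ideal_R"
      using Q(4) by (simp add: maximalideal_def ideal_def additive_subgroup.zero_closed)
    ultimately have "{\<zero>\<^bsub>?Q\<^esub>} \<subset> ?h ` max_ideal_R" by blast
    then show "\<forall>i<1. ?p i \<subset> ?p (Suc i)" by simp
  qed
  ultimately have dim: "krull_dim ?Q = enat (card {?h x_R})" by (simp add: one_enat_def antisym)
  have "max_ideal ?Q = Idl\<^bsub>?Q\<^esub> {?h x_R}" unfolding Q(3)
  proof
    show "Idl\<^bsub>?Q\<^esub> {?h x_R} \<subseteq> ?h ` max_ideal_R"
      using max_ideal_R_gens by (intro h.S.genideal_minimal maximalideal.axioms(1)[OF Q(4)]) auto
    let ?J = "{r \<in> carrier type_ring. ?h r \<in> Idl\<^bsub>?Q\<^esub> {?h x_R}}"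
    have J: "ideal ?J type_ring" by (rule h.ideal_vimage[OF h.S.genideal_ideal[OF t]])
    have NJ: "ideal_N \<subseteq> ?J"
      using quotient_in_Idl_singleton[OF ideal_N_ideal, of _ x_R] by (auto intro!: exI[of _ 0])
    have xJ: "x_R \<in> ?J" using h.S.genideal_self[OF t] by simp
    have "max_ideal_R \<subseteq> ?J"
      using NJ two_in_N xJ y_in_if_t_in[OF J NJ xJ] by (intro max_ideal_R_subset[OF J]) auto
    then show "?h ` max_ideal_R \<subseteq> Idl\<^bsub>?Q\<^esub> {?h x_R}" by auto
  qed
  then show ?thesis
    unfolding regular_local_ring_def using Q(1,2) t dim by (intro conjI exI[of _ "{?h x_R}"]) auto
qed

text \<open>Hence \<open>x\<close> and \<open>y\<close> stay linearly independent in the cotangent space of \<open>R/P\<close>.\<close>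

lemma ideal_P_linear:
  assumes "f \<in> ideal_P"
  shows "2 dvd fps_nth (fps_nth f 0) 0" "2 dvd fps_nth (fps_nth f 0) 1" "2 dvd fps_nth (fps_nth f 1) 0"
proof -
  obtain u v where "f = u * 2 + v * (y_R ^ 2 - x_R ^ 3)"
    using assms unfolding ideal_P_def ring_R_eq Idl_pair by blast
  \<comment> \<open>Both \<open>y^2\<close> and \<open>x^3\<close> have order at least 2, so in
    total degree at most 1 only \<open>2 * u\<close> contributes.\<close>
  then have "f = fps_const (fps_const 2) * u + (fps_X ^ 2 * v - fps_const (fps_X ^ 3) * v)"
    by (simp add: y_R_def x_R_def fps_const_power numeral_fps_const algebra_simps)
  then show "2 dvd fps_nth (fps_nth f 0) 0" "2 dvd fps_nth (fps_nth f 0) 1" "2 dvd fps_nth (fps_nth f 1) 0"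
    by (simp_all add: fps_X_power_mult_nth)
qed

lemma not_regular_quotient_P: "\<not> regular_local_ring (type_ring Quot ideal_P)"
proof
  let ?Q = "type_ring Quot ideal_P"
  let ?h = "(+>\<^bsub>type_ring\<^esub>) ideal_P"
  note Q = max_ideal_quotient[OF max_ideal_R_local ideal_P_ideal ideal_P_le_max]
  interpret h: ring_hom_ring type_ring ?Q ?h by (rule ideal.rcos_ring_hom_ring[OF ideal_P_ideal])
  assume "regular_local_ring ?Q"
  then obtain A where A: "A \<subseteq> carrier ?Q" "finite A" "enat (card A) = krull_dim ?Q"
    "?h ` max_ideal_R = Idl\<^bsub>?Q\<^esub> A"
    by (auto simp: regular_local_ring_def Q(3))
  have "krull_dim ?Q \<le> enat (card {x_R})"
  proof (rule krull_dim_quotient_le[OF max_ideal_R_local(1) ideal_P_ideal max_ideal_R_props(4)])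
    show "Q = max_ideal_R" if "primeideal Q type_ring" "ideal_P \<subseteq> Q" "{x_R} \<subseteq> Q" for Q
      using that two_in_P y_in_if_x_in by (intro prime_eq_max_ideal_R) auto
  qed (use prime_le_max_ideal_R max_ideal_R_gens in auto)
  then have "card A \<le> 1" using A(3) by (metis enat_ord_simps(1) is_singletonI is_singleton_altdef)
  moreover have "\<zero>\<^bsub>?Q\<^esub> \<in> ?h ` max_ideal_R"
    using Q(4) by (simp add: maximalideal_def ideal_def additive_subgroup.zero_closed)
  moreover have "A \<subseteq> ?h ` max_ideal_R" unfolding A(4) by (rule h.S.genideal_self[OF A(1)])
  \<comment> \<open>\<open>A\<close> may be empty; the zero class then serves as
    \<open>z\<close>.\<close>
  ultimately obtain z where z: "z \<in> ?h ` max_ideal_R" "A \<subseteq> {z}"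
    using card_le_Suc0_iff_eq[OF A(2)] by (metis One_nat_def empty_subsetI insertI1 subsetD subsetI singletonI)
  then obtain a where a: "a \<in> max_ideal_R" "z = ?h a" by blast
  have sub: "?h ` max_ideal_R \<subseteq> Idl\<^bsub>?Q\<^esub> {?h a}"
    unfolding A(4) using z(2) a(2) h.hom_closed[of a] by (intro h.S.subset_Idl_subset) auto
  obtain r where r: "x_R - r * a \<in> ideal_P"
    using sub max_ideal_R_gens(2) quotient_in_Idl_singleton[OF ideal_P_ideal] by blast
  obtain s where s: "y_R - s * a \<in> ideal_P"
    using sub max_ideal_R_gens(3) quotient_in_Idl_singleton[OF ideal_P_ideal] by blast
  \<comment> \<open>\<open>c f i j\<close> is the coefficient of \<open>x^i y^j\<close>. As
    \<open>a\<close> has even constant term, only the constant terms of \<open>r\<close> and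
    \<open>s\<close> matter in degree 1 modulo 2: the first \<open>x\<close> congruence makes
    \<open>c r 0 0\<close> odd, the second then makes \<open>c a 0 1\<close> even, and this
    contradicts the congruence for \<open>y\<close>.\<close>
  define c where "c f i j = fps_nth (fps_nth f j) i" for f :: "padic2 fps fps" and i j
  have even_a: "2 dvd c a 0 0" using a(1) by (simp add: max_ideal_R_def fps_ideal_def c_def)
  have x: "2 dvd 1 - (c r 0 0 * c a 1 0 + c r 1 0 * c a 0 0)"
    "2 dvd 0 - (c r 0 0 * c a 0 1 + c r 0 1 * c a 0 0)"
    using ideal_P_linear(2,3)[OF r] by (simp_all add: c_def x_R_def fps_mult_nth)
  have y: "2 dvd 1 - (c s 0 0 * c a 0 1 + c s 0 1 * c a 0 0)"
    using ideal_P_linear(3)[OF s] by (simp add: c_def y_R_def fps_mult_nth)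
  have prime: "2 dvd u * v \<Longrightarrow> 2 dvd u \<or> 2 dvd v" for u v :: padic2
    using prime_multD[OF prime_even_padic2, of u v] by simp
  have drop: "2 dvd u - v * w" if "2 dvd u - (v * w + v' * c a 0 0)" for u v w v'
  proof -
    have "2 dvd (u - (v * w + v' * c a 0 0)) + v' * c a 0 0"
      using that even_a by (intro dvd_add dvd_mult)
    then show ?thesis by simp
  qed
  have "\<not> 2 dvd c r 0 0"
  proof
    assume "2 dvd c r 0 0"
    then have "2 dvd (1 - c r 0 0 * c a 1 0) + c r 0 0 * c a 1 0"
      using drop[OF x(1)] by (intro dvd_add dvd_mult2)
    then show False using two_not_dvd_one_padic2 by simp
  qed
  moreover have "2 dvd c r 0 0 * c a 0 1" using drop[OF x(2)] by simp
  ultimately have "2 dvd c a 0 1" using prime by blast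
  then have "2 dvd (1 - c s 0 0 * c a 0 1) + c s 0 0 * c a 0 1"
    using drop[OF y] by (intro dvd_add dvd_mult)
  then show False using two_not_dvd_one_padic2 by simp
qed

theorem theorem1p2:
  shows "(complete_regular_local_ring ring_R \<and> char_zero ring_R \<and>
          complete_regular_local_ring ring_S \<and> char_zero ring_S) \<and>
         (free_of_rank ring_R (restrict_scalars phi ring_S) 2 \<and> primeideal ideal_P ring_R) \<and>
         (regular_local_ring (ring_S Quot ideal_radical ring_S ideal_PS) \<and>
          \<not> regular_local_ring (ring_R Quot ideal_P))"
  using complete_regular_data_imp[OF complete_regular_R] char_zero_type_ring free_of_rank_S prime_P
    regular_quotient_N not_regular_quotient_P ideal_radical_PS
  by (simp add: ring_R_eq ring_S_eq)

end
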